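(* Let $A=\langle\langle a,b\rangle\rangle$ be a commutative algebra generated by two primitive axes $a,b$, with $a$ of type $\lambda$. Then all nontrivial idempotents of $A$ are primitive axes of $A$, and they are explicitly described (the descriptions are listed in the context). If $\lambda\neq\frac12$, then $A$ contains exactly $6$ nontrivial idempotents, and all primitive axes of $A$ of the same type are conjugate with respect to a Miyamoto involution. If $\lambda=\frac12$, write $b=\alpha_ba+b_0+b_\lambda$ with $\alpha_b\in\mathbb F$, $b_0\in A_0(a)$, $b_\lambda\in A_\lambda(a)$. Then: (1) If $\alpha_b\neq0$, then the primitive axis $b$ is conjugate to $a$ with respect to a Miyamoto involution if and only if $\mathbb F$ contains a square root of $\alpha_b$. (2) If $\alpha_b=0$, let $E_d=\{d+\rho b_\lambda:\rho\in\mathbb F\}$ for $d\in\{a,\mathbf 1-a\}$, where $\mathbf 1$ is the identity element of $A$. Then $E_d=\{e_1^{\tau_e}: e\text{ a primitive axis of }A\}$ for any $e_1\in E_d$.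
   Context: Algebras are not necessarily associative or unital. $\mathbb F$ is a field of characteristic $\neq2$, $A$ is a commutative $\mathbb F$-algebra, and $\langle\langle X\rangle\rangle$ is the subalgebra generated by $X$. An idempotent of $A$ is nontrivial if it is distinct from $0$ and from the identity element $\mathbf 1$ of $A$ (if one exists). For an idempotent $a\in A$ and $\mu\in\mathbb F$ let $A_\mu(a)=\{y\in A:ay=\mu y\}$. For $\lambda\in\mathbb F\setminus\{0,1\}$, a primitive axis of type $\lambda$ is a nonzero idempotent $a\in A$ with $A_1(a)=\mathbb Fa$ such that $A=\mathbb Fa\oplus A_0(a)\oplus A_\lambda(a)$ and this is a $\mathbb Z_2$-grading with even part $\mathbb Fa\oplus A_0(a)$ and odd part $A_\lambda(a)$. The Miyamoto involution of such an axis is the automorphism $\tau_a$ of $A$ that is the identity on $\mathbb Fa\oplus A_0(a)$ and $-1$ on $A_\lambda(a)$; $x^{\tau_a}$ denotes $\tau_a(x)$. Two primitive axes $c,d$ of $A$ are conjugate with respect to a Miyamoto involution if $c^{\tau_e}=d$ for some primitive axis $e\in A$. Explicit descriptions of the nontrivial idempotents. For any $\lambda$, write $b=\alpha_ba+b_0+b_\lambda$ as in the claim, let $\lambda'$ be the type of $b$, and put $\sigma=ab-\lambda'a-\lambda b$ and $\gamma=\alpha_b(1-\lambda)-\lambda'$. If $ab\neq0$ and $\dim A=2$: they are $\mu a+(1-\mu)b$ $(\mu\in\mathbb F)$ when $\lambda=\frac12$, and $a,\,b,\,-a-b$ when $\lambda=-1\neq\frac12$; no other $\lambda$ occurs. If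 $\dim A=3$ and $\gamma=0$: they are $\mu a+(1-\mu)b+2\mu(1-\mu)\sigma$ $(\mu\in\mathbb F)$ when $\lambda=\frac12$, and $a,\,b,\,-a-b+2\sigma$ when $\lambda=-1\neq\frac12$; no other $\lambda$ occurs. If $\dim A=3$ and $\gamma\neq0$, then $\mathbf 1=\sigma/\gamma$ is the identity element of $A$; when $\lambda\neq\frac12$ they are $a,\ \mathbf 1-a,\ b,\ \mathbf 1-b,\ b^{\tau_a},\ \mathbf 1-b^{\tau_a}$; when $\lambda=\frac12$ they are the elements $\alpha a+(1-\alpha)(\mathbf 1-a)+\rho b_\lambda$ with $\alpha,\rho\in\mathbb F$ and $\rho^2\alpha_b(1-\alpha_b)=\alpha(1-\alpha)$.
   Formalization: For λ≠1/2, "exactly 6 nontrivial idempotents" is claimed only when dim A=3 and γ≠0 (otherwise there are 0, 2 or 3), and conjugacy of all primitive axes of the same type only when ab≠0: if ab=0, then a and b share every type but all Miyamoto involutions are trivial. *)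

theory Defs
  imports Complex_Main
begin

locale comm_algebra = vector_space scale
  for scale :: "'f::field \<Rightarrow> 'a::ab_group_add \<Rightarrow> 'a" (infixr "*s" 75) +
  fixes mult :: "'a \<Rightarrow> 'a \<Rightarrow> 'a" (infixl "\<odot>" 70)
  assumes mult_commute: "x \<odot> y = y \<odot> x"
    and mult_add_left: "(x + y) \<odot> z = x \<odot> z + y \<odot> z"
    and mult_scale_left: "(c *s x) \<odot> y = c *s (x \<odot> y)"
begin

definition subalgebra :: "'a set \<Rightarrow> bool" where
  "subalgebra S \<longleftrightarrow> subspace S \<and> (\<forall>x\<in>S. \<forall>y\<in>S. x \<odot> y \<in> S)"

definition generated_subalgebra :: "'a set \<Rightarrow> 'a set" where
  "generated_subalgebra X = subalgebra hull X"

definition is_identity :: "'a \<Rightarrow> bool" where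
  "is_identity u \<longleftrightarrow> (\<forall>x. u \<odot> x = x)"

definition idempotent :: "'a \<Rightarrow> bool" where
  "idempotent e \<longleftrightarrow> e \<odot> e = e"

definition nontrivial_idempotent :: "'a \<Rightarrow> bool" where
  "nontrivial_idempotent e \<longleftrightarrow> idempotent e \<and> e \<noteq> 0 \<and> \<not> is_identity e"

definition eigenspace :: "'f \<Rightarrow> 'a \<Rightarrow> 'a set" where
  "eigenspace \<mu> a = {y. a \<odot> y = \<mu> *s y}"

definition even_part :: "'a \<Rightarrow> 'a set" where
  "even_part a = {u + v | u v. u \<in> span {a} \<and> v \<in> eigenspace 0 a}"

(* If the eigenspace for lam vanishes, an axis has every lam other than 0 and 1 as a type. *)
definition primitive_axis_of_type :: "'f \<Rightarrow> 'a \<Rightarrow> bool" where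
  "primitive_axis_of_type lam a \<longleftrightarrow>
     lam \<noteq> 0 \<and> lam \<noteq> 1 \<and> a \<noteq> 0 \<and> idempotent a \<and>
     eigenspace 1 a = span {a} \<and>
     (\<forall>x. \<exists>!p \<in> span {a} \<times> eigenspace 0 a \<times> eigenspace lam a.
        x = fst p + fst (snd p) + snd (snd p)) \<and>
     (\<forall>x\<in>even_part a. \<forall>y\<in>even_part a. x \<odot> y \<in> even_part a) \<and>
     (\<forall>x\<in>even_part a. \<forall>y\<in>eigenspace lam a. x \<odot> y \<in> eigenspace lam a) \<and>
     (\<forall>x\<in>eigenspace lam a. \<forall>y\<in>eigenspace lam a. x \<odot> y \<in> even_part a)"

definition primitive_axis :: "'a \<Rightarrow> bool" where
  "primitive_axis a \<longleftrightarrow> (\<exists>lam. primitive_axis_of_type lam a)"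

definition automorphism :: "('a \<Rightarrow> 'a) \<Rightarrow> bool" where
  "automorphism t \<longleftrightarrow>
     Vector_Spaces.linear scale scale t \<and> bij t \<and> (\<forall>x y. t (x \<odot> y) = t x \<odot> t y)"

(* Meaningful only if a is a primitive axis of type lam; then exactly one t qualifies. *)
definition miyamoto :: "'f \<Rightarrow> 'a \<Rightarrow> 'a \<Rightarrow> 'a" where
  "miyamoto lam a =
     (THE t. automorphism t \<and> (\<forall>x\<in>even_part a. t x = x) \<and> (\<forall>x\<in>eigenspace lam a. t x = - x))"

definition conjugate :: "'a \<Rightarrow> 'a \<Rightarrow> bool" where
  "conjugate c d \<longleftrightarrow>
     (\<exists>e lam. primitive_axis_of_type lam e \<and> miyamoto lam e c = d)"

end

end

theory Submission
  imports Defs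
begin

text \<open>Put \<open>\<sigma> = a b - \<lambda>' a - \<lambda> b\<close>. Decomposing with respect to \<open>a\<close> gives \<open>a \<sigma> = \<gamma> a\<close>, and with respect to \<open>b\<close>
  it gives \<open>b \<sigma> = \<gamma>' b\<close>; comparing the two resulting formulas for \<open>\<sigma>\<^sup>2\<close> forces \<open>\<gamma> = \<gamma>'\<close>. So if
  \<open>b\<^sub>\<lambda> \<noteq> 0\<close>, then \<open>A\<close> is spanned by \<open>a, b\<^sub>0, b\<^sub>\<lambda>\<close>, with a multiplication table determined by \<open>\<lambda>\<close> and \<open>\<alpha>\<^sub>b\<close>;
  the idempotents are then read off in coordinates. For \<open>\<lambda> \<noteq> \<onehalf>\<close> the symmetry comes from three axes
  with \<open>x y = (\<lambda> / 2) (x + y - z)\<close>, of which one is \<open>a\<close> and another is \<open>b\<close> or \<open>\<one> - b\<^sup>\<tau>\<close>; each Miyamoto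
  involution swaps the other two. For \<open>\<lambda> = \<onehalf>\<close> and \<open>\<gamma> \<noteq> 0\<close> the algebra is the Jordan algebra of a
  binary quadratic form, its axes are the vectors of norm 1, and Miyamoto involutions are reflections.\<close>

text \<open>Why \<open>\<sigma>\<close> works: subtracting \<open>\<lambda> b\<close> removes from
  \<open>a b\<close> the odd component with respect to \<open>a\<close>, and subtracting
  \<open>\<lambda>' a\<close> does the same with respect to \<open>b\<close>, so
  \<open>\<sigma>\<close> is even for both axes. Idempotence of \<open>b\<close> alone yields only
  the sum of the squares of \<open>b\<^sub>0\<close> and \<open>b\<^sub>\<lambda>\<close>; the
  action of \<open>b\<close> on \<open>\<sigma>\<close> is what separates the two. With
  \<open>d = - \<gamma> / \<lambda>\<close> one has
  \<open>\<sigma> = - \<lambda> (d a + b\<^sub>0)\<close>, the square of \<open>b\<^sub>0\<close> is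
  \<open>d b\<^sub>0\<close>, and for \<open>d \<noteq> 0\<close> the identity is
  \<open>a + b\<^sub>0 / d\<close>. The obstacle is degeneration. The vector
  \<open>b\<^sub>0\<close> may vanish, which is dimension 2; coordinates are therefore taken with
  respect to vectors that may be zero, so that dimensions 2 and 3 share one computation. For
  \<open>\<lambda> = - 1\<close> the three axes may sum to zero, so a multiple of
  \<open>\<sigma>\<close> is carried along beside them. If \<open>b\<^sub>\<lambda> = 0\<close>, the
  type of \<open>a\<close> is not determined by \<open>a\<close>, and this case is kept
  apart.\<close>

text \<open>Eliminating \<open>g\<close> from the two relations gives
  \<open>(lam' - lam) * (lam' - (1 - lam)) = 0\<close>. For \<open>lam = 1 / 2\<close> the first
  relation loses \<open>g\<close>, so it fixes \<open>lam'\<close> and leaves \<open>al\<close>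
  free; otherwise \<open>g\<close>, and with it \<open>al\<close>, is a function of
  \<open>lam\<close> in each of the two branches. Only the branch \<open>lam' = lam\<close> allows
  \<open>g = 0\<close>, since the other has \<open>2 * g = - lam * (1 - lam)\<close>.\<close>

lemma type_parameters:
  fixes lam lam' al g d :: "'f::field"
  assumes two: "(2::'f) \<noteq> 0" and lam: "lam \<noteq> 0" "lam \<noteq> 1"
    and g: "g = al * (1 - lam) - lam'" and d: "d = - g / lam"
    and 1: "g * (1 - 2 * lam) = lam * (2 * lam * lam' + lam - 1) / 2"
    and 2: "g * (1 - 2 * lam') = lam' * (2 * lam * lam' + lam' - 1) / 2"
  shows "lam = 1 / 2 \<Longrightarrow> lam' = 1 / 2 \<and> 2 * g = al - 1 \<and> d = 1 - al"
    "lam \<noteq> 1 / 2 \<Longrightarrow> (lam' = lam \<and> 2 * al = lam \<and> 2 * d = 1 + lam) \<or>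
       (lam' = 1 - lam \<and> 2 * al = 2 - lam \<and> 2 * d = 1 - lam)"
    "lam \<noteq> 1 / 2 \<Longrightarrow> g = 0 \<Longrightarrow> lam = - 1 \<and> lam' = - 1 \<and> 2 * al = - 1 \<and> d = 0"
proof -
  show half: "lam' = 1 / 2 \<and> 2 * g = al - 1 \<and> d = 1 - al" if h: "lam = 1 / 2"
  proof -
    have 2: "2 * lam = 1" unfolding h using two by simp
    have "lam * (2 * lam * lam' + lam - 1) = 0" using 1 two by (simp add: 2)
    then have "lam' + lam = 1" using lam by (simp add: 2)
    then have "2 * lam' = 1" using 2 by algebra
    then have l: "lam' = 1 / 2" using two by (simp add: field_simps)
    have "2 * g = al - 1" unfolding g l h using two by (simp add: field_simps)
    moreover from this have "d = 1 - al" unfolding d h using two by (simp add: field_simps)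
    ultimately show ?thesis using l by blast
  qed
  have gen: "(lam' = lam \<and> 2 * al = lam \<and> 2 * d = 1 + lam \<and> 2 * g = - lam * (lam + 1)) \<or>
       (lam' = 1 - lam \<and> 2 * al = 2 - lam \<and> 2 * d = 1 - lam \<and> 2 * g = - lam * (1 - lam))" if h: "lam \<noteq> 1 / 2"
  proof -
    have nz: "1 - 2 * lam \<noteq> 0" using h two by (auto simp: field_simps)
    have g1: "2 * g * (1 - 2 * lam) = lam * (2 * lam * lam' + lam - 1)" using 1 two by (simp add: field_simps)
    have g2: "2 * g * (1 - 2 * lam') = lam' * (2 * lam * lam' + lam' - 1)" using 2 two by (simp add: field_simps)
    have "lam * (2 * lam * lam' + lam - 1) * (1 - 2 * lam') = lam' * (2 * lam * lam' + lam' - 1) * (1 - 2 * lam)"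
      unfolding g1[symmetric] g2[symmetric] by (simp add: algebra_simps)
    then have "(lam' - lam) * (lam' - (1 - lam)) = 0" by algebra
    then have "lam' = lam \<or> lam' = 1 - lam" by auto
    moreover have al: "al * (1 - lam) = g + lam'" using g by simp
    ultimately show ?thesis
    proof (elim disjE)
      assume l: "lam' = lam"
      have "(1 - 2 * lam) * (2 * g) = (1 - 2 * lam) * (- lam * (lam + 1))" using g1 unfolding l by algebra
      then have G: "2 * g = - lam * (lam + 1)" using mult_left_cancel[OF nz] by blast
      have "(1 - lam) * (2 * al) = (1 - lam) * lam" using al G unfolding l by algebra
      then have "2 * al = lam" using lam by simp
      moreover have "2 * d = 1 + lam"
      proof -
        have "lam * d = - g" unfolding d using lam by simp
        then have "lam * (2 * d) = lam * (1 + lam)" using G by algebra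
        then show ?thesis using lam by simp
      qed
      ultimately show ?thesis using l G by blast
    next
      assume l: "lam' = 1 - lam"
      have "(1 - 2 * lam) * (2 * g) = (1 - 2 * lam) * (- lam * (1 - lam))" using g1 unfolding l by algebra
      then have G: "2 * g = - lam * (1 - lam)" using mult_left_cancel[OF nz] by blast
      have "(1 - lam) * (2 * al) = (1 - lam) * (2 - lam)" using al G unfolding l by algebra
      then have "2 * al = 2 - lam" using lam by simp
      moreover have "2 * d = 1 - lam"
      proof -
        have "lam * d = - g" unfolding d using lam by simp
        then have "lam * (2 * d) = lam * (1 - lam)" using G by algebra
        then show ?thesis using lam by simp
      qed
      ultimately show ?thesis using l G by blast
    qed
  qed
  then show "lam \<noteq> 1 / 2 \<Longrightarrow> (lam' = lam \<and> 2 * al = lam \<and> 2 * d = 1 + lam) \<or>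
       (lam' = 1 - lam \<and> 2 * al = 2 - lam \<and> 2 * d = 1 - lam)" by blast
  show "lam = - 1 \<and> lam' = - 1 \<and> 2 * al = - 1 \<and> d = 0" if "lam \<noteq> 1 / 2" "g = 0"
  proof -
    have "lam + 1 = 0 \<and> lam' = lam" using gen[OF that(1)] lam that(2) by auto
    then have "lam = - 1" "lam' = - 1" by (auto simp: add_eq_0_iff2)
    then show ?thesis using gen[OF that(1)] d that(2) lam by auto
  qed
qed

context comm_algebra
begin

section \<open>Bilinear multiplication and coordinates\<close>

lemma mult_add_right: "z \<odot> (x + y) = z \<odot> x + z \<odot> y"
  by (metis mult_commute mult_add_left)

lemma mult_scale_right: "x \<odot> (c *s y) = c *s (x \<odot> y)"
  by (metis mult_commute mult_scale_left)

lemma mult_zero [simp]: "0 \<odot> x = 0" "x \<odot> 0 = 0"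
  using mult_scale_left[of 0 0 x] mult_scale_right[of x 0 0] by simp_all

lemma mult_minus: "(- x) \<odot> y = - (x \<odot> y)" "x \<odot> (- y) = - (x \<odot> y)"
  using mult_scale_left[of "-1" x y] mult_scale_right[of x "-1" y] by simp_all

lemma mult_diff: "(x - y) \<odot> z = x \<odot> z - y \<odot> z" "z \<odot> (x - y) = z \<odot> x - z \<odot> y"
  using mult_add_left[of x "-y" z] mult_add_right[of z x "-y"] by (simp_all add: mult_minus)

lemmas mult_linear = mult_add_left mult_add_right mult_scale_left mult_scale_right mult_minus mult_diff

text \<open>The vectors \<open>p\<close>, \<open>q\<close>, \<open>r\<close> may be dependent or
  zero. This lets the same coordinates serve algebras of dimension 1, 2 and 3.\<close>

definition comb3 :: "'a \<Rightarrow> 'a \<Rightarrow> 'a \<Rightarrow> 'f \<Rightarrow> 'f \<Rightarrow> 'f \<Rightarrow> 'a" where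
  "comb3 p q r x y z = x *s p + y *s q + z *s r"

lemma comb3_add: "comb3 p q r x y z + comb3 p q r x' y' z' = comb3 p q r (x + x') (y + y') (z + z')"
  by (simp add: comb3_def scale_left_distrib algebra_simps)

lemma comb3_diff: "comb3 p q r x y z - comb3 p q r x' y' z' = comb3 p q r (x - x') (y - y') (z - z')"
  by (simp add: comb3_def scale_left_diff_distrib algebra_simps)

lemma comb3_minus: "- comb3 p q r x y z = comb3 p q r (- x) (- y) (- z)"
  by (simp add: comb3_def)

lemma comb3_scale: "c *s comb3 p q r x y z = comb3 p q r (c * x) (c * y) (c * z)"
  by (simp add: comb3_def scale_right_distrib)

lemma comb3_basis: "comb3 p q r 1 0 0 = p" "comb3 p q r 0 1 0 = q" "comb3 p q r 0 0 1 = r"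
  "comb3 p q r 0 0 0 = 0"
  by (simp_all add: comb3_def)

lemmas comb3_linear = comb3_add comb3_diff comb3_minus comb3_scale

lemma comb3_mult:
  "comb3 p q r x y z \<odot> comb3 p q r x' y' z' =
     (x * x') *s (p \<odot> p) + (y * y') *s (q \<odot> q) + (z * z') *s (r \<odot> r) +
     (x * y' + y * x') *s (p \<odot> q) + (x * z' + z * x') *s (p \<odot> r) + (y * z' + z * y') *s (q \<odot> r)"
  by (simp add: comb3_def mult_linear scale_right_distrib scale_left_distrib mult_commute[of q p]
      mult_commute[of r p] mult_commute[of r q] algebra_simps)

lemma comb3_cong:
  "x = x' \<Longrightarrow> y = y' \<Longrightarrow> z = z' \<Longrightarrow> comb3 p q r x y z = comb3 p q r x' y' z'"
  by simp

lemma comb3_generates: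
  assumes gen: "generated_subalgebra X = UNIV"
    and C: "C = {comb3 p q r x y z | x y z. True}"
    and X: "X \<subseteq> C"
    and prods: "p \<odot> p \<in> C" "q \<odot> q \<in> C" "r \<odot> r \<in> C" "p \<odot> q \<in> C" "p \<odot> r \<in> C" "q \<odot> r \<in> C"
  shows "C = UNIV"
proof -
  have sub: "subspace C"
  proof (rule subspaceI)
    show "0 \<in> C" unfolding C using comb3_basis(4)[of p q r, symmetric] by blast
    show "x + y \<in> C" if "x \<in> C" "y \<in> C" for x y
      using that unfolding C by (auto simp: comb3_add) blast
    show "c *s x \<in> C" if "x \<in> C" for c x
      using that unfolding C by (auto simp: comb3_scale) blast
  qed
  have "subalgebra C"
    unfolding subalgebra_def
  proof (intro conjI ballI sub)
    fix s t assume "s \<in> C" "t \<in> C"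
    then obtain x y z x' y' z' where "s = comb3 p q r x y z" "t = comb3 p q r x' y' z'"
      unfolding C by auto
    then show "s \<odot> t \<in> C"
      by (simp only: comb3_mult) (intro subspace_add[OF sub] subspace_scale[OF sub] prods)
  qed
  then have "generated_subalgebra X \<subseteq> C"
    unfolding generated_subalgebra_def using X by (intro hull_minimal)
  then show ?thesis using gen by auto
qed

subsection \<open>Axes in coordinates\<close>

text \<open>Eigenvectors for the distinct eigenvalues 1, 0, \<open>lam\<close> are independent:
  applying \<open>e\<close> once and twice kills \<open>f\<close> and leaves two equations in
  \<open>u\<close> and \<open>w\<close>.\<close>

lemma eigen_zero:
  assumes "lam \<noteq> 0" "lam \<noteq> 1" "e \<odot> u = u" "e \<odot> f = 0" "e \<odot> w = lam *s w" "u + f + w = 0"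
  shows "u = 0" "f = 0" "w = 0"
proof -
  have 1: "u + lam *s w = 0"
    using arg_cong[OF assms(6), of "\<lambda>x. e \<odot> x"] assms(3-5) by (simp add: mult_linear)
  have 2: "u + (lam * lam) *s w = 0"
    using arg_cong[OF 1, of "\<lambda>x. e \<odot> x"] assms(3-5) by (simp add: mult_linear)
  have "(lam * lam - lam) *s w = 0"
    using arg_cong2[OF 2 1, of "(-)"] by (simp only: scale_left_diff_distrib add_diff_cancel_left diff_self)
  moreover have "lam * lam - lam \<noteq> 0" using assms(1,2) by (auto simp: algebra_simps)
  ultimately show "w = 0" by auto
  then show "u = 0" using 1 by auto
  then show "f = 0" using \<open>w = 0\<close> assms(6) by auto
qed

lemma eigen_unique:
  assumes "lam \<noteq> 0" "lam \<noteq> 1" "e \<odot> u = u" "e \<odot> f = 0" "e \<odot> w = lam *s w"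
    "e \<odot> u' = u'" "e \<odot> f' = 0" "e \<odot> w' = lam *s w'" "u + f + w = u' + f' + w'"
  shows "u = u'" "f = f'" "w = w'"
proof -
  have "(u - u') + (f - f') + (w - w') = 0" using assms(9) by (simp add: algebra_simps)
  moreover have "e \<odot> (u - u') = u - u'" "e \<odot> (f - f') = 0" "e \<odot> (w - w') = lam *s (w - w')"
    using assms(3-8) by (simp_all add: mult_linear scale_right_diff_distrib)
  ultimately have "u - u' = 0" "f - f' = 0" "w - w' = 0" using eigen_zero[OF assms(1,2)] by blast+
  then show "u = u'" "f = f'" "w = w'" by simp_all
qed

text \<open>Since the eigenvectors \<open>e\<close>, \<open>f\<close>, \<open>w\<close> span, each
  eigenspace is the line (or zero) through one of them, and the three remaining products decide the
  grading. All axes other than the two given ones are recognised through this criterion.\<close>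

lemma axisI:
  assumes lam: "lam \<noteq> 0" "lam \<noteq> 1" and e: "e \<noteq> 0" "e \<odot> e = e" and f: "e \<odot> f = 0" and w: "e \<odot> w = lam *s w"
    and ff: "f \<odot> f = c1 *s e + c2 *s f" and fw: "f \<odot> w = c3 *s w"
    and ww: "w \<odot> w = c4 *s e + c5 *s f"
    and span: "\<And>x. \<exists>c d g. x = comb3 e f w c d g"
  shows "primitive_axis_of_type lam e"
proof -
  have eig1: "\<exists>c. x = c *s e" if x: "e \<odot> x = x" for x
  proof -
    obtain c d g where *: "x = comb3 e f w c d g" using span by blast
    have "x = c *s e + d *s f + g *s w" using * by (simp add: comb3_def)
    then have "x + 0 + 0 = c *s e + d *s f + g *s w" by simp
    from eigen_unique(1)[OF lam x _ _ _ _ _ this] show ?thesis using e f w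
      by (auto simp: mult_linear scale_left_commute)
  qed
  have eig0: "\<exists>c. x = c *s f" if x: "e \<odot> x = 0" for x
  proof -
    obtain c d g where *: "x = comb3 e f w c d g" using span by blast
    have "x = c *s e + d *s f + g *s w" using * by (simp add: comb3_def)
    then have "0 + x + 0 = c *s e + d *s f + g *s w" by simp
    from eigen_unique(2)[OF lam _ x _ _ _ _ this] show ?thesis using e f w
      by (auto simp: mult_linear scale_left_commute)
  qed
  have eigl: "\<exists>c. x = c *s w" if x: "e \<odot> x = lam *s x" for x
  proof -
    obtain c d g where *: "x = comb3 e f w c d g" using span by blast
    have "x = c *s e + d *s f + g *s w" using * by (simp add: comb3_def)
    then have "0 + 0 + x = c *s e + d *s f + g *s w" by simp
    from eigen_unique(3)[OF lam _ _ x _ _ _ this] show ?thesis using e f w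
      by (auto simp: mult_linear scale_left_commute)
  qed
  have E1: "eigenspace 1 e = span {e}"
    using eig1 e by (auto simp: eigenspace_def span_singleton mult_linear)
  have E0: "eigenspace 0 e = {c *s f | c. True}"
    using eig0 f by (auto simp: eigenspace_def mult_linear)
  have EL: "eigenspace lam e = {c *s w | c. True}"
    using eigl w by (auto simp: eigenspace_def mult_linear scale_left_commute)
  have EV: "even_part e = {c *s e + d *s f | c d. True}"
    unfolding even_part_def E0 span_singleton by blast
  have uniq: "\<exists>!p \<in> span {e} \<times> eigenspace 0 e \<times> eigenspace lam e. x = fst p + fst (snd p) + snd (snd p)" for x
  proof -
    obtain c d g where *: "x = c *s e + d *s f + g *s w" using span unfolding comb3_def by blast
    show ?thesis
    proof (rule ex1I[of _ "(c *s e, d *s f, g *s w)"])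
      show "(c *s e, d *s f, g *s w) \<in> span {e} \<times> eigenspace 0 e \<times> eigenspace lam e \<and>
        x = fst (c *s e, d *s f, g *s w) + fst (snd (c *s e, d *s f, g *s w)) + snd (snd (c *s e, d *s f, g *s w))"
        using * unfolding E0 EL span_singleton by auto
    next
      fix p assume p: "p \<in> span {e} \<times> eigenspace 0 e \<times> eigenspace lam e \<and> x = fst p + fst (snd p) + snd (snd p)"
      obtain u h v where P: "p = (u, h, v)" by (cases p) auto
      have "e \<odot> u = u" "e \<odot> h = 0" "e \<odot> v = lam *s v"
        using p unfolding P E1[symmetric] by (auto simp: eigenspace_def)
      from eigen_unique[OF lam this, of "c *s e" "d *s f" "g *s w"] p P * e f w
      show "p = (c *s e, d *s f, g *s w)" by (auto simp: mult_linear scale_left_commute)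
    qed
  qed
  show ?thesis
    unfolding primitive_axis_of_type_def
  proof (intro conjI ballI lam e E1 allI uniq)
    show "idempotent e" using e by (simp add: idempotent_def)
    show "x \<odot> y \<in> even_part e" if xy: "x \<in> even_part e" "y \<in> even_part e" for x y
    proof -
      obtain c d c' d' where "x = c *s e + d *s f" "y = c' *s e + d' *s f" using xy unfolding EV by blast
      then have "x \<odot> y = (c * c' + d * d' * c1) *s e + (d * d' * c2) *s f"
        using e f ff by (simp add: mult_linear scale_right_distrib scale_left_distrib mult_commute[of f e] ac_simps)
      then show ?thesis unfolding EV by blast
    qed
    show "x \<odot> y \<in> eigenspace lam e" if xy: "x \<in> even_part e" "y \<in> eigenspace lam e" for x y
    proof -
      obtain c d c' where "x = c *s e + d *s f" "y = c' *s w" using xy unfolding EV EL by blast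
      then have "x \<odot> y = (c * c' * lam + d * c' * c3) *s w"
        using w fw by (simp add: mult_linear scale_right_distrib scale_left_distrib ac_simps)
      then show ?thesis unfolding EL by blast
    qed
    show "x \<odot> y \<in> even_part e" if xy: "x \<in> eigenspace lam e" "y \<in> eigenspace lam e" for x y
    proof -
      obtain c c' where "x = c *s w" "y = c' *s w" using xy unfolding EL by blast
      then have "x \<odot> y = (c * c' * c4) *s e + (c * c' * c5) *s f"
        using ww by (simp add: mult_linear scale_right_distrib ac_simps)
      then show ?thesis unfolding EV by blast
    qed
  qed
qed

section \<open>Consequences of the axis axioms\<close>

lemma axisD:
  assumes "primitive_axis_of_type lam a"
  shows "lam \<noteq> 0" "lam \<noteq> 1" "a \<noteq> 0" "a \<odot> a = a"
  using assms by (auto simp: primitive_axis_of_type_def idempotent_def)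

lemma axis_eigenspace_1:
  assumes "primitive_axis_of_type lam a" "a \<odot> x = x"
  obtains c where "x = c *s a"
proof -
  have "x \<in> eigenspace 1 a" using assms(2) by (simp add: eigenspace_def)
  then show ?thesis using assms(1) that by (auto simp: primitive_axis_of_type_def span_singleton)
qed

lemma axis_decompose:
  assumes "primitive_axis_of_type lam a"
  obtains c f w where "x = c *s a + f + w" "a \<odot> f = 0" "a \<odot> w = lam *s w"
proof -
  have "\<exists>p \<in> span {a} \<times> eigenspace 0 a \<times> eigenspace lam a. x = fst p + fst (snd p) + snd (snd p)"
    using assms unfolding primitive_axis_of_type_def by blast
  then show ?thesis using that by (auto simp: eigenspace_def span_singleton)
qed

lemma in_even_part_iff: "x \<in> even_part a \<longleftrightarrow> (\<exists>c f. x = c *s a + f \<and> a \<odot> f = 0)"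
  by (auto simp: even_part_def eigenspace_def span_singleton)

lemma axis_even_even:
  assumes "primitive_axis_of_type lam a" "a \<odot> f = 0" "a \<odot> g = 0"
  obtains c h where "f \<odot> g = c *s a + h" "a \<odot> h = 0"
proof -
  have "f \<in> even_part a" "g \<in> even_part a"
    using assms(2,3) by (force simp: in_even_part_iff intro: exI[of _ 0])+
  then have "f \<odot> g \<in> even_part a" using assms(1) by (simp add: primitive_axis_of_type_def)
  then show ?thesis using that by (auto simp: in_even_part_iff)
qed

lemma axis_even_odd:
  assumes "primitive_axis_of_type lam a" "a \<odot> f = 0" "a \<odot> w = lam *s w"
  shows "a \<odot> (f \<odot> w) = lam *s (f \<odot> w)"
proof -
  have "f \<in> even_part a" "w \<in> eigenspace lam a"
    using assms(2,3) by (force simp: in_even_part_iff eigenspace_def intro: exI[of _ 0])+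
  then have "f \<odot> w \<in> eigenspace lam a" using assms(1) by (simp add: primitive_axis_of_type_def)
  then show ?thesis by (simp add: eigenspace_def)
qed

lemma axis_odd_odd:
  assumes "primitive_axis_of_type lam a" "a \<odot> v = lam *s v" "a \<odot> w = lam *s w"
  obtains c h where "v \<odot> w = c *s a + h" "a \<odot> h = 0"
proof -
  have "v \<in> eigenspace lam a" "w \<in> eigenspace lam a"
    using assms(2,3) by (auto simp: eigenspace_def)
  then have "v \<odot> w \<in> even_part a" using assms(1) by (simp add: primitive_axis_of_type_def)
  then show ?thesis using that by (auto simp: in_even_part_iff)
qed

section \<open>The Miyamoto involution as an explicit map\<close>

text \<open>On \<open>e + f + w\<close> with \<open>f\<close>, \<open>w\<close> in the eigenspaces for \<open>0\<close>, \<open>lam\<close>, the operator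
  \<open>x \<mapsto> e x - e (e x)\<close> is \<open>lam (1 - lam)\<close> times the projection to \<open>w\<close>.\<close>

definition tau :: "'f \<Rightarrow> 'a \<Rightarrow> 'a \<Rightarrow> 'a" where
  "tau lam e z = z - (2 / (lam * (1 - lam))) *s (e \<odot> z - e \<odot> (e \<odot> z))"

lemma tau_decomposed:
  assumes "lam \<noteq> 0" "lam \<noteq> 1" "e \<odot> e = e" "e \<odot> f = 0" "e \<odot> w = lam *s w"
  shows "tau lam e (c *s e + f + w) = c *s e + f - w"
proof -
  have "e \<odot> (c *s e + f + w) - e \<odot> (e \<odot> (c *s e + f + w)) = (lam * (1 - lam)) *s w"
    using assms by (simp add: mult_linear scale_left_diff_distrib right_diff_distrib)
  then have "tau lam e (c *s e + f + w) = c *s e + f + w - (2::'f) *s w"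
    using assms(1,2) by (simp add: tau_def)
  also have "(2::'f) *s w = w + w" using scale_left_distrib[of 1 1 w] by simp
  finally show ?thesis by (simp add: algebra_simps)
qed

lemma tau_add: "tau lam e (x + y) = tau lam e x + tau lam e y"
  by (simp add: tau_def mult_linear scale_right_distrib scale_right_diff_distrib algebra_simps)

lemma tau_scale: "tau lam e (c *s x) = c *s tau lam e x"
  by (simp add: tau_def mult_linear scale_right_diff_distrib algebra_simps)

text \<open>Changing the sign of the odd part respects products because the decomposition is a
  grading.\<close>

lemma tau_automorphism:
  assumes ax: "primitive_axis_of_type lam e"
  shows "automorphism (tau lam e)" "tau lam e (tau lam e x) = x"
proof -
  note D = axisD[OF ax]
  have dec: "tau lam e (c *s e + f + w) = c *s e + f - w" if "e \<odot> f = 0" "e \<odot> w = lam *s w" for c f w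
    using tau_decomposed D that by blast
  have inv: "tau lam e (tau lam e x) = x" for x
  proof -
    obtain c f w where x: "x = c *s e + f + w" "e \<odot> f = 0" "e \<odot> w = lam *s w"
      using axis_decompose[OF ax] by blast
    show ?thesis using dec[OF x(2,3)] dec[OF x(2), of "-w" c] x by (simp add: mult_linear)
  qed
  show "tau lam e (tau lam e x) = x" by (rule inv)
  have mult: "tau lam e (x \<odot> y) = tau lam e x \<odot> tau lam e y" for x y
  proof -
    obtain c f w where x: "x = c *s e + f + w" "e \<odot> f = 0" "e \<odot> w = lam *s w"
      using axis_decompose[OF ax] by blast
    obtain c' f' w' where y: "y = c' *s e + f' + w'" "e \<odot> f' = 0" "e \<odot> w' = lam *s w'"
      using axis_decompose[OF ax] by blast
    obtain d h where ff: "f \<odot> f' = d *s e + h" "e \<odot> h = 0" using axis_even_even[OF ax x(2) y(2)] .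
    obtain d' h' where ww: "w \<odot> w' = d' *s e + h'" "e \<odot> h' = 0" using axis_odd_odd[OF ax x(3) y(3)] .
    have fw: "e \<odot> (f \<odot> w') = lam *s (f \<odot> w')" "e \<odot> (f' \<odot> w) = lam *s (f' \<odot> w)"
      using axis_even_odd[OF ax] x y by blast+
    \<comment> \<open>The odd part of \<open>x \<odot> y\<close>. Each summand contains exactly one
      of \<open>w\<close>, \<open>w'\<close>, so negating both negates \<open>W\<close>, whereas
      \<open>w \<odot> w'\<close> in the even part is unchanged.\<close>
    define W where "W = (c * lam) *s w' + (c' * lam) *s w + f \<odot> w' + f' \<odot> w"
    have W: "e \<odot> W = lam *s W"
      using fw x y by (simp add: W_def mult_linear scale_right_distrib ac_simps)
    have H: "e \<odot> (h + h') = 0" using ff ww by (simp add: mult_linear)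
    have "x \<odot> y = (c * c' + d + d') *s e + (h + h') + W"
      using x y ff ww D by (simp add: W_def mult_linear scale_right_distrib scale_left_distrib
        mult_commute[of f e] mult_commute[of w e] mult_commute[of w f'] ac_simps)
    moreover have "(c *s e + f - w) \<odot> (c' *s e + f' - w') = (c * c' + d + d') *s e + (h + h') - W"
      using x y ff ww D by (simp add: W_def mult_linear scale_right_distrib scale_left_distrib
        mult_commute[of f e] mult_commute[of w e] mult_commute[of w f'] algebra_simps)
    ultimately show ?thesis using dec[OF H W] dec[OF x(2,3)] dec[OF y(2,3)] x(1) y(1) by simp
  qed
  show "automorphism (tau lam e)"
    unfolding automorphism_def
  proof (intro conjI allI mult)
    show "Vector_Spaces.linear scale scale (tau lam e)"
      by unfold_locales (simp_all add: tau_add tau_scale scale_right_distrib scale_left_distrib)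
    show "bij (tau lam e)" using inv by (intro o_bij[of "tau lam e"]) auto
  qed
qed

text \<open>Replaces the definite description by a formula. Uniqueness needs only linearity of
  \<open>t\<close>, since even and odd part together span.\<close>

lemma miyamoto_eq_tau:
  assumes ax: "primitive_axis_of_type lam e"
  shows "miyamoto lam e = tau lam e"
  unfolding miyamoto_def
proof (rule the_equality)
  note D = axisD[OF ax]
  have dec: "tau lam e (c *s e + f + w) = c *s e + f - w" if "e \<odot> f = 0" "e \<odot> w = lam *s w" for c f w
    using tau_decomposed D that by blast
  show "automorphism (tau lam e) \<and> (\<forall>x\<in>even_part e. tau lam e x = x) \<and> (\<forall>x\<in>eigenspace lam e. tau lam e x = - x)"
    using dec[of _ 0] dec[of 0 _ 0] by (auto simp: tau_automorphism[OF ax] in_even_part_iff eigenspace_def)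
  fix t assume t: "automorphism t \<and> (\<forall>x\<in>even_part e. t x = x) \<and> (\<forall>x\<in>eigenspace lam e. t x = - x)"
  show "t = tau lam e"
  proof
    fix x
    obtain c f w where x: "x = c *s e + f + w" "e \<odot> f = 0" "e \<odot> w = lam *s w"
      using axis_decompose[OF ax] by blast
    have "c *s e + f \<in> even_part e" "w \<in> eigenspace lam e"
      using x by (auto simp: in_even_part_iff eigenspace_def)
    then have "t (c *s e + f) = c *s e + f" "t w = - w"
      using t by blast+
    moreover have "t (c *s e + f + w) = t (c *s e + f) + t w"
    proof -
      interpret t: Vector_Spaces.linear scale scale t using t by (simp add: automorphism_def)
      show ?thesis by (rule t.add)
    qed
    ultimately show "t x = tau lam e x" using dec[OF x(2,3)] x(1) by simp
  qed
qed

lemma conjugateI: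
  assumes "primitive_axis_of_type lam e" "tau lam e c = d"
  shows "conjugate c d"
  using assms miyamoto_eq_tau unfolding conjugate_def by fastforce

lemma conjugate_iff: "conjugate c d \<longleftrightarrow> (\<exists>e lam. primitive_axis_of_type lam e \<and> tau lam e c = d)"
  using miyamoto_eq_tau unfolding conjugate_def by metis

section \<open>Eigenvector coordinates, dimension, uniqueness of the type\<close>

lemma comb3_eq_iff:
  assumes "lam \<noteq> 0" "lam \<noteq> 1" "a \<noteq> 0" "a \<odot> a = a" "a \<odot> n = 0" "a \<odot> v = lam *s v"
  shows "comb3 a n v x y z = comb3 a n v x' y' z' \<longleftrightarrow> x = x' \<and> (y = y' \<or> n = 0) \<and> (z = z' \<or> v = 0)"
proof
  assume "comb3 a n v x y z = comb3 a n v x' y' z'"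
  then have eq: "x *s a + y *s n + z *s v = x' *s a + y' *s n + z' *s v" by (simp add: comb3_def)
  note u = eigen_unique[where e = a, OF assms(1,2) _ _ _ _ _ _ eq]
  have "x *s a = x' *s a" "y *s n = y' *s n" "z *s v = z' *s v"
    by (rule u; use assms in \<open>simp add: mult_linear mult.commute\<close>)+
  then show "x = x' \<and> (y = y' \<or> n = 0) \<and> (z = z' \<or> v = 0)" using assms(3) by auto
next
  assume "x = x' \<and> (y = y' \<or> n = 0) \<and> (z = z' \<or> v = 0)"
  then show "comb3 a n v x y z = comb3 a n v x' y' z'" by (auto simp: comb3_def)
qed

lemma dim_eigenbasis:
  assumes e: "lam \<noteq> 0" "lam \<noteq> 1" "a \<noteq> 0" "a \<odot> a = a" "a \<odot> n = 0" "a \<odot> v = lam *s v"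
    and span: "\<And>u. \<exists>x y z. u = comb3 a n v x y z"
  shows "dim (UNIV :: 'a set) = 1 + (if n = 0 then 0 else 1) + (if v = 0 then 0 else 1)"
proof -
  define B where "B = {a} \<union> (if n = 0 then {} else {n}) \<union> (if v = 0 then {} else {v})"
  have "u \<in> span B" for u
  proof -
    obtain x y z where u: "u = comb3 a n v x y z" using span by blast
    have "a \<in> span B" "n \<in> span B" "v \<in> span B"
      by (auto simp: B_def span_zero intro: span_base)
    then show ?thesis unfolding u comb3_def by (intro span_add span_scale)
  qed
  then have B: "UNIV \<subseteq> span B" by blast
  have a: "a \<notin> span {n, v}"
  proof
    assume "a \<in> span {n, v}"
    then obtain k l where "a = k *s n + l *s v"
      by (auto simp: span_breakdown_eq algebra_simps)
    then have "comb3 a n v 1 0 0 = comb3 a n v 0 k l" by (simp add: comb3_def)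
    then show False using comb3_eq_iff[OF e] by simp
  qed
  have n: "n \<notin> span {v}" if "n \<noteq> 0"
  proof
    assume "n \<in> span {v}"
    then obtain l where "n = l *s v" by (auto simp: span_breakdown_eq)
    then have "comb3 a n v 0 1 0 = comb3 a n v 0 0 l" by (simp add: comb3_def)
    then show False using comb3_eq_iff[OF e] that by simp
  qed
  have vi: "independent {v}" if "v \<noteq> 0" using that by (intro independent_insertI independent_empty) auto
  have ni: "independent {n}" if "n \<noteq> 0" using that by (intro independent_insertI independent_empty) auto
  have nv: "independent {n, v}" if "n \<noteq> 0" "v \<noteq> 0" by (rule independent_insertI[OF n[OF that(1)] vi[OF that(2)]])
  have mono: "a \<notin> span S" if "S \<subseteq> {n, v}" for S using a span_mono[OF that] by blast
  have ind: "independent B"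
  proof -
    let ?S = "(if n = 0 then {} else {n}) \<union> (if v = 0 then {} else {v})"
    have "independent ?S" using vi ni nv independent_empty by (simp add: insert_commute)
    moreover have "a \<notin> span ?S" by (rule mono) simp
    ultimately have "independent (insert a ?S)" by (intro independent_insertI)
    then show ?thesis by (simp add: B_def Un_assoc)
  qed
  have "n \<noteq> v" if "n \<noteq> 0" "v \<noteq> 0" using n[OF that(1)] span_base[of v "{v}"] by auto
  moreover have "a \<noteq> n" "a \<noteq> v" using a span_base[of n "{n,v}"] span_base[of v "{n,v}"] by auto
  ultimately have "card B = 1 + (if n = 0 then 0 else 1) + (if v = 0 then 0 else 1)"
    unfolding B_def by auto
  then show ?thesis using B ind by (intro dim_unique[of B]) auto
qed

text \<open>The only eigenvalues of an axis are 1, 0 and its type. A nonzero odd vector is required,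
  because an axis without one has every admissible type.\<close>

lemma axis_type_unique:
  assumes ax: "primitive_axis_of_type mu e" and w: "e \<odot> w = lam *s w" "w \<noteq> 0" "lam \<noteq> 0" "lam \<noteq> 1"
  shows "mu = lam"
proof -
  note D = axisD[OF ax]
  obtain c f w' where d: "w = c *s e + f + w'" "e \<odot> f = 0" "e \<odot> w' = mu *s w'" using axis_decompose[OF ax] .
  have "c *s e + 0 + mu *s w' = e \<odot> w" using d D by (simp add: mult_linear)
  also have "\<dots> = lam *s (c *s e + f + w')" using w(1) d(1) by metis
  also have "\<dots> = (lam * c) *s e + lam *s f + lam *s w'" by (simp add: scale_right_distrib)
  finally have eq: "c *s e + 0 + mu *s w' = (lam * c) *s e + lam *s f + lam *s w'" .
  note u = eigen_unique[where e = e, OF D(1,2) _ _ _ _ _ _ eq]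
  have "c *s e = (lam * c) *s e" "0 = lam *s f" "mu *s w' = lam *s w'"
    by (rule u; use D d(2,3) in \<open>simp add: mult_linear mult.commute\<close>)+
  then have "c = 0" "f = 0" and mu: "mu = lam \<or> w' = 0" using D w(3,4) by auto
  then have "w = w'" using d(1) by simp
  then show ?thesis using mu w(2) by simp
qed

lemma axis_identity:
  assumes "primitive_axis_of_type mu e" "is_identity e"
  shows "\<exists>c. u = c *s e"
proof -
  have "e \<odot> u = u" using assms(2) by (simp add: is_identity_def)
  then show ?thesis using axis_eigenspace_1[OF assms(1)] by blast
qed

text \<open>The 1-eigenspace of an identity is the whole algebra, while that of a primitive axis is
  a line; a nonzero \<open>n\<close> or \<open>v\<close> besides \<open>a\<close> makes the algebra
  too large for that.\<close>

lemma axis_nontrivial: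
  assumes ax: "primitive_axis_of_type mu e"
    and e: "lam \<noteq> 0" "lam \<noteq> 1" "a \<noteq> 0" "a \<odot> a = a" "a \<odot> n = 0" "a \<odot> v = lam *s v" "n \<noteq> 0 \<or> v \<noteq> 0"
  shows "nontrivial_idempotent e"
proof -
  have False if id: "is_identity e"
  proof -
    obtain c where c: "a = c *s e" using axis_identity[OF ax id] by blast
    obtain x where x: "n = x *s e" using axis_identity[OF ax id] by blast
    obtain y where y: "v = y *s e" using axis_identity[OF ax id] by blast
    \<comment> \<open>Both sides equal \<open>(c * (x + y)) *s e\<close>.\<close>
    have "comb3 a n v (x + y) 0 0 = comb3 a n v 0 c c"
      unfolding comb3_def using c x y by (simp add: scale_left_distrib distrib_left mult.commute)
    then have "c = 0 \<or> (n = 0 \<and> v = 0)" using comb3_eq_iff[OF e(1-6)] by auto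
    then show False using c e by auto
  qed
  then show ?thesis using axisD[OF ax] by (auto simp: nontrivial_idempotent_def idempotent_def)
qed

subsection \<open>Two generating axes\<close>

text \<open>Compare the components of \<open>b \<odot> b = b\<close>: by the grading
  \<open>n \<odot> v\<close> is odd, while \<open>n \<odot> n\<close> and \<open>v \<odot> v\<close>
  are even. Only the sum of these two squares becomes known here.\<close>

lemma idempotent_decomposed:
  assumes ax: "primitive_axis_of_type lam a" and two: "(2::'f) \<noteq> 0"
    and b: "b = al *s a + n + v" "b \<odot> b = b" and n: "a \<odot> n = 0" and v: "a \<odot> v = lam *s v"
  shows "n \<odot> v = (1 / 2 - al * lam) *s v" "n \<odot> n + v \<odot> v = (al - al * al) *s a + n"
proof -
  note D = axisD[OF ax]
  obtain c h where nn: "n \<odot> n = c *s a + h" "a \<odot> h = 0" using axis_even_even[OF ax n n] .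
  obtain d g where vv: "v \<odot> v = d *s a + g" "a \<odot> g = 0" using axis_odd_odd[OF ax v v] .
  have nv: "a \<odot> (n \<odot> v) = lam *s (n \<odot> v)" by (rule axis_even_odd[OF ax n v])
  have "(al * al + c + d) *s a + (h + g) + ((al * lam) *s v + (al * lam) *s v + (n \<odot> v + n \<odot> v)) = b \<odot> b"
    using D n v nn(1) vv(1) unfolding b(1)
    by (simp add: mult_linear mult_commute[of n a] mult_commute[of v a] mult_commute[of v n]
        scale_right_distrib scale_left_distrib algebra_simps)
  also have "\<dots> = al *s a + n + v" using b by simp
  finally have eq: "(al * al + c + d) *s a + (h + g) + ((al * lam) *s v + (al * lam) *s v + (n \<odot> v + n \<odot> v)) = al *s a + n + v" .
  note u = eigen_unique[where e = a, OF D(1,2) _ _ _ _ _ _ eq]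
  have u1: "(al * al + c + d) *s a = al *s a" and u2: "h + g = n"
    and u3: "(al * lam) *s v + (al * lam) *s v + (n \<odot> v + n \<odot> v) = v"
    by (rule u; use D n v nn(2) vv(2) nv in \<open>simp add: mult_linear scale_right_distrib mult.left_commute mult.commute\<close>)+
  have "al * al + c + d = al" using u1 D(3) by simp
  then have cd: "c + d = al - al * al" by (simp add: algebra_simps)
  have "2 *s (n \<odot> v) = (1 - 2 * al * lam) *s v"
  proof -
    have "2 *s (n \<odot> v) = n \<odot> v + n \<odot> v" using scale_left_distrib[of 1 1 "n \<odot> v"] by simp
    moreover have "(1 - 2 * al * lam) *s v = v - ((al * lam) *s v + (al * lam) *s v)"
      using scale_left_distrib[of "al * lam" "al * lam" v] by (simp add: scale_left_diff_distrib mult.assoc)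
    ultimately show ?thesis using u3 by (simp add: algebra_simps)
  qed
  then have "(1/2) *s (2 *s (n \<odot> v)) = (1/2) *s ((1 - 2 * al * lam) *s v)" by simp
  then show "n \<odot> v = (1 / 2 - al * lam) *s v"
    using two by (simp add: diff_divide_distrib)
  have "n \<odot> n + v \<odot> v = (c + d) *s a + (h + g)"
    using nn(1) vv(1) by (simp add: scale_left_distrib algebra_simps)
  then show "n \<odot> n + v \<odot> v = (al - al * al) *s a + n" using cd u2 by simp
qed

lemma axes_without_odd_part:
  assumes ax: "primitive_axis_of_type lam a" "primitive_axis_of_type lam' b"
    and ab: "a \<odot> b = al *s a"
  shows "a \<odot> b = 0 \<or> a = b"
proof -
  note D = axisD[OF ax(1)] and D' = axisD[OF ax(2)]
  obtain c f w where a: "a = c *s b + f + w" "b \<odot> f = 0" "b \<odot> w = lam' *s w"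
    using axis_decompose[OF ax(2)] .
  have ba: "b \<odot> a = al *s a" using ab by (simp add: mult_commute)
  consider "al = 0" | "al = 1" | "al \<noteq> 0" "al \<noteq> 1" by blast
  then show ?thesis
  proof cases
    case 1 then show ?thesis using ab by simp
  next
    case 2
    then obtain k where k: "a = k *s b" using axis_eigenspace_1[OF ax(2)] ba by auto
    then have "(k * k - k) *s b = 0" using D(4) D'(4) by (simp add: mult_linear scale_left_diff_distrib)
    then have "k * (k - 1) = 0" using D'(3) by (simp add: algebra_simps)
    then show ?thesis using k D(3) by auto
  next
    case 3
    have "c *s b + 0 + lam' *s w = b \<odot> a" using a D' by (simp add: mult_linear)
    also have "\<dots> = (al * c) *s b + al *s f + al *s w" using ba unfolding a(1) by (simp add: scale_right_distrib)
    finally have eq: "c *s b + 0 + lam' *s w = (al * c) *s b + al *s f + al *s w" .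
    note u = eigen_unique[where e = b, OF D'(1,2) _ _ _ _ _ _ eq]
    have "c *s b = (al * c) *s b" "0 = al *s f"
      by (rule u; use D' a in \<open>simp add: mult_linear mult.commute\<close>)+
    then have "f = 0" "c = 0" using 3 D'(3) by auto
    \<comment> \<open>Having an eigenvalue other than 0 and 1, \<open>a\<close> would be odd with
      respect to \<open>b\<close>; but \<open>a = a \<odot> a\<close> is then also even, hence
      zero.\<close>
    then have w: "a = w" using a by simp
    obtain d h where "a \<odot> a = d *s b + h" "b \<odot> h = 0"
      using axis_odd_odd[OF ax(2) a(3) a(3)] w by auto
    then have eq: "d *s b + h + 0 = 0 + 0 + a" using D by simp
    have "0 = a"
      by (rule eigen_unique(3)[where e = b, OF D'(1,2) _ _ _ _ _ _ eq]) (use D' a w \<open>b \<odot> h = 0\<close> in \<open>simp_all add: mult_linear\<close>)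
    then show ?thesis using D(3) by simp
  qed
qed

text \<open>The term \<open>lam *s b\<close> cancels the component \<open>v\<close> of
  \<open>a \<odot> b\<close>. The left side is symmetric in the two axes, so the lemma applies to
  \<open>b\<close> as well, with the types exchanged.\<close>

lemma sigma_eq:
  assumes "primitive_axis_of_type lam a" "b = al *s a + n + v" "a \<odot> n = 0" "a \<odot> v = lam *s v"
  shows "a \<odot> b - lam' *s a - lam *s b = (al * (1 - lam) - lam') *s a - lam *s n"
  using axisD[OF assms(1)] assms(2-)
  by (simp add: mult_linear scale_right_distrib scale_left_distrib scale_left_diff_distrib algebra_simps)

text \<open>Everything is read off from \<open>b \<odot> s = g' *s b\<close>: its odd component
  gives the scalar relation, its even components give \<open>n \<odot> n\<close>, and then
  \<open>s \<odot> s\<close> follows. The constants \<open>g\<close> and \<open>g'\<close> are kept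
  different because their equality is deduced from this formula and its mirror image.\<close>

lemma sigma_square:
  assumes ax: "primitive_axis_of_type lam a" and two: "(2::'f) \<noteq> 0"
    and b: "b = al *s a + n + v" "b \<odot> b = b" and n: "a \<odot> n = 0" and v: "a \<odot> v = lam *s v" "v \<noteq> 0"
    and s: "s = g *s a - lam *s n" "b \<odot> s = g' *s b"
  shows "g' = lam * g - lam / 2 + al * lam\<^sup>2"
    "lam *s (n \<odot> n) = (al * (g - g')) *s a - g' *s n"
    "s \<odot> s = g' *s s + ((g - g') * (g + lam * al)) *s a"
proof -
  note D = axisD[OF ax]
  define k where "k = 1 / 2 - al * lam"
  have nv: "n \<odot> v = k *s v" unfolding k_def by (rule idempotent_decomposed(1)[OF ax two b n v(1)])
  obtain c h where nn: "n \<odot> n = c *s a + h" "a \<odot> h = 0" using axis_even_even[OF ax n n] .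
  have "(g * al - lam * c) *s a + (- lam *s h) + (g * lam - lam * k) *s v = b \<odot> s"
    unfolding b(1) s(1) using D n v nn(1) nv
    by (simp add: mult_linear mult_commute[of n a] mult_commute[of v a] mult_commute[of v n]
        scale_right_distrib scale_left_distrib scale_left_diff_distrib scale_right_diff_distrib algebra_simps)
  also have "\<dots> = (g' * al) *s a + g' *s n + g' *s v"
    using s(2) unfolding b(1) by (simp add: scale_right_distrib)
  finally have eq: "(g * al - lam * c) *s a + (- lam *s h) + (g * lam - lam * k) *s v
     = (g' * al) *s a + g' *s n + g' *s v" .
  note u = eigen_unique[where e = a, OF D(1,2) _ _ _ _ _ _ eq]
  have u1: "(g * al - lam * c) *s a = (g' * al) *s a" and u2: "- lam *s h = g' *s n"
    and u3: "(g * lam - lam * k) *s v = g' *s v"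
    by (rule u; use D n v nn in \<open>simp add: mult_linear mult.commute\<close>)+
  have "g * lam - lam * k = g'" using u3 v(2) by simp
  then show "g' = lam * g - lam / 2 + al * lam\<^sup>2" by (simp add: k_def algebra_simps power2_eq_square)
  have c: "lam * c = al * (g - g')"
  proof -
    have "g * al - lam * c = g' * al" using u1 D(3) by simp
    then show ?thesis by (simp add: algebra_simps)
  qed
  have lh: "lam *s h = - (g' *s n)" using u2 by (metis minus_minus scale_minus_left)
  show N: "lam *s (n \<odot> n) = (al * (g - g')) *s a - g' *s n"
    using nn(1) lh c by (simp add: scale_right_distrib)
  have "s \<odot> s = (g * g) *s a + lam *s (lam *s (n \<odot> n))"
    unfolding s(1) using D n by (simp add: mult_linear mult_commute[of n a])
  also have "\<dots> = g' *s s + ((g - g') * (g + lam * al)) *s a"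
    unfolding N s(1) by (simp add: scale_right_diff_distrib scale_left_distrib scale_left_diff_distrib algebra_simps)
  finally show "s \<odot> s = g' *s s + ((g - g') * (g + lam * al)) *s a" .
qed

text \<open>The scalar \<open>d\<close> arises from \<open>lam *s (n \<odot> n) = - g *s n\<close>,
  which is what \<open>sigma_square\<close> says once \<open>g' = g\<close>. The last two
  conclusions are one relation seen from each axis, with the coefficient of the decomposition
  eliminated.\<close>

lemma two_axes_table:
  assumes ax: "primitive_axis_of_type lam a" "primitive_axis_of_type lam' b" and two: "(2::'f) \<noteq> 0"
    and gen: "generated_subalgebra {a, b} = UNIV"
    and b: "b = al *s a + n + v" and n: "a \<odot> n = 0" and v: "a \<odot> v = lam *s v" "v \<noteq> 0"
    and g: "g = al * (1 - lam) - lam'"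
  defines "d \<equiv> - g / lam"
  shows "n \<odot> n = d *s n" "n \<odot> v = (d * (1 - lam)) *s v"
    "v \<odot> v = (al - al * al) *s a + (1 - d) *s n"
    "2 * al * lam + 2 * d * (1 - lam) = 1"
    "n = 0 \<Longrightarrow> g = 0"
    "\<exists>x y z. u = comb3 a n v x y z"
    "g * (1 - 2 * lam) = lam * (2 * lam * lam' + lam - 1) / 2"
    "g * (1 - 2 * lam') = lam' * (2 * lam * lam' + lam' - 1) / 2"
proof -
  note D = axisD[OF ax(1)] and D' = axisD[OF ax(2)]
  define s where "s = a \<odot> b - lam' *s a - lam *s b"
  obtain be m w where a: "a = be *s b + m + w" "b \<odot> m = 0" "b \<odot> w = lam' *s w"
    using axis_decompose[OF ax(2)] .
  define g' where "g' = be * (1 - lam') - lam"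
  have s: "s = g *s a - lam *s n" unfolding s_def g by (rule sigma_eq[OF ax(1) b n v(1)])
  have s': "s = g' *s b - lam' *s m" using sigma_eq[OF ax(2) a, of lam]
    unfolding s_def g'_def by (simp add: mult_commute algebra_simps)
  have as: "a \<odot> s = g *s a" unfolding s using D n by (simp add: mult_linear)
  have bs: "b \<odot> s = g' *s b" unfolding s' using D' a by (simp add: mult_linear)
  have ab: "a \<odot> b = al *s a + lam *s v" unfolding b using D n v by (simp add: mult_linear)

  \<comment> \<open>Makes the situation symmetric, so that \<open>sigma_square\<close> may be used
    from the side of \<open>b\<close>. Without an odd part of \<open>a\<close> the axes would be
    orthogonal or equal, and both contradict \<open>v \<noteq> 0\<close>.\<close>
  have w: "w \<noteq> 0"
  proof
    assume "w = 0"
    then have "b \<odot> a = be *s b" using a D' by (simp add: mult_linear)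
    then consider "a \<odot> b = 0" | "b = a" using axes_without_odd_part[OF ax(2,1)] by (auto simp: mult_commute)
    then show False
    proof cases
      case 1
      then have eq: "al *s a + 0 + lam *s v = 0" using ab by simp
      have "lam *s v = 0"
        by (rule eigen_zero(3)[where e = a, OF D(1,2) _ _ _ eq]) (use D v in \<open>simp_all add: mult_linear\<close>)
      then show False using D v by simp
    next
      case 2
      then have eq: "al *s a + n + v = a + 0 + 0" using b by simp
      have "v = 0"
        by (rule eigen_unique(3)[where e = a, OF D(1,2) _ _ _ _ _ _ eq]) (use D n v in \<open>simp_all add: mult_linear\<close>)
      then show False using v by simp
    qed
  qed
  note S = sigma_square[OF ax(1) two b D'(4) n v s bs]
  note S' = sigma_square[OF ax(2) two a(1) D(4) a(2,3) w s' as]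
  \<comment> \<open>The two formulas for \<open>s \<odot> s\<close> give \<open>E\<close>. There
    \<open>Y *s b\<close> is the only term that is not even for \<open>a\<close>, so
    \<open>Y = 0\<close>, and likewise \<open>X = 0\<close> from the side of \<open>b\<close>. For
    \<open>g' \<noteq> g\<close> this leaves \<open>s = 0\<close>, whence both constants
    vanish.\<close>
  have gg: "g' = g"
  proof (rule ccontr)
    assume ne: "g' \<noteq> g"
    define X where "X = (g - g') * (g + lam * al)"
    define Y where "Y = (g' - g) * (g' + lam' * be)"
    have E: "g' *s s + X *s a = g *s s + Y *s b"
      using S(3) S'(3) unfolding X_def Y_def by simp
    have eq: "(g' * g + X) *s a + (- (g' * lam) *s n) + 0
       = (g * g + Y * al) *s a + (Y *s n - (g * lam) *s n) + Y *s v"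
      using E unfolding s b
      by (simp add: scale_right_distrib scale_left_distrib scale_right_diff_distrib algebra_simps)
    have "0 = Y *s v"
      by (rule eigen_unique(3)[where e = a, OF D(1,2) _ _ _ _ _ _ eq])
        (use D n v in \<open>simp_all add: mult_linear mult.commute\<close>)
    then have Y: "Y = 0" using v by simp
    have eq: "(g * g' + Y) *s b + (- (g * lam') *s m) + 0
       = (g' * g' + X * be) *s b + (X *s m - (g' * lam') *s m) + X *s w"
    proof -
      have "g *s s + Y *s b = g' *s s + X *s (be *s b + m + w)" using E a(1) by simp
      then show ?thesis unfolding s'
        by (simp add: scale_right_distrib scale_left_distrib scale_right_diff_distrib algebra_simps)
    qed
    have "0 = X *s w"
      by (rule eigen_unique(3)[where e = b, OF D'(1,2) _ _ _ _ _ _ eq])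
        (use D' a(2,3) in \<open>simp_all add: mult_linear mult.commute\<close>)
    then have X: "X = 0" using w by simp
    have "g' *s s = g *s s" using E X Y by simp
    then have "s = 0" using ne by simp
    then have "g *s a = 0" "g' *s b = 0" using as bs by simp_all
    then show False using ne D(3) D'(3) by simp
  qed
  have lamd: "lam * d = - g" using D by (simp add: d_def)
  have "lam *s (n \<odot> n) = lam *s (d *s n)" using S(2) lamd gg by simp
  then show nn: "n \<odot> n = d *s n" using D by (simp only: scale_cancel_left) simp
  have k1: "g = lam * g - lam / 2 + al * lam\<^sup>2" using S(1) gg by simp
  have k2: "g = lam' * g - lam' / 2 + be * lam'\<^sup>2" using S'(1) gg by simp
  have "lam * (1 / 2 - al * lam) = lam * d * (1 - lam)"
    unfolding lamd using k1 by (simp add: algebra_simps power2_eq_square)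
  then have kd: "1 / 2 - al * lam = d * (1 - lam)" using D by simp
  then show nv: "n \<odot> v = (d * (1 - lam)) *s v"
    using idempotent_decomposed(1)[OF ax(1) two b D'(4) n v(1)] by simp
  have "2 * (1 / 2 - al * lam) = 2 * (d * (1 - lam))" using kd by simp
  then show "2 * al * lam + 2 * d * (1 - lam) = 1" using two by (simp add: algebra_simps)
  show vv: "v \<odot> v = (al - al * al) *s a + (1 - d) *s n"
    using idempotent_decomposed(2)[OF ax(1) two b D'(4) n v(1)] nn
    by (simp add: scale_left_diff_distrib algebra_simps)
  \<comment> \<open>Here \<open>s = g *s a\<close>, so \<open>b \<odot> s = g *s b\<close> compares
    the odd parts \<open>(g * lam) *s v\<close> and \<open>g *s v\<close>, and
    \<open>lam \<noteq> 1\<close>.\<close>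
  show "g = 0" if "n = 0"
  proof -
    have "g *s (a \<odot> b) = g *s b" using bs unfolding s that gg by (simp add: mult_linear mult_commute)
    then have "(g * lam - g) *s v = 0"
      unfolding ab using that unfolding b by (simp add: scale_right_distrib scale_left_diff_distrib)
    then have "g * (lam - 1) = 0" using v by (simp add: algebra_simps)
    then show ?thesis using D by simp
  qed
  have "{comb3 a n v x y z | x y z. True} = UNIV"
  proof (rule comb3_generates[OF gen refl])
    let ?C = "{comb3 a n v x y z | x y z. True}"
    have C: "u \<in> ?C" if "u = comb3 a n v x y z" for u x y z using that by blast
    show "{a, b} \<subseteq> ?C" using C[of a 1 0 0] C[of b al 1 1] by (simp add: comb3_def b)
    show "a \<odot> a \<in> ?C" using C[of _ 1 0 0] D by (simp add: comb3_def)
    show "n \<odot> n \<in> ?C" by (rule C[of _ 0 d 0]) (simp add: comb3_def nn)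
    show "v \<odot> v \<in> ?C" by (rule C[of _ "al - al * al" "1 - d" 0]) (simp add: comb3_def vv)
    show "a \<odot> n \<in> ?C" by (rule C[of _ 0 0 0]) (simp add: comb3_def n)
    show "a \<odot> v \<in> ?C" by (rule C[of _ 0 0 lam]) (simp add: comb3_def v)
    show "n \<odot> v \<in> ?C" by (rule C[of _ 0 0 "d * (1 - lam)"]) (simp add: comb3_def nv)
  qed
  then show "\<exists>x y z. u = comb3 a n v x y z" by blast
  \<comment> \<open>Eliminates the coefficient \<open>A\<close>, which stands for \<open>al\<close>
    on the side of \<open>a\<close> and for \<open>be\<close> on the side of
    \<open>b\<close>.\<close>
  have field: "G * (1 - 2 * l) = l * (2 * l * l' + l - 1) / 2"
    if 1: "G = l * G - l / 2 + A * l\<^sup>2" and 2: "G = A * (1 - l) - l'" for G l l' A :: 'f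
  proof -
    have "A * (1 - l) = G + l'" using 2 by (simp add: algebra_simps)
    moreover have "2 * G = 2 * l * G - l + 2 * A * l\<^sup>2"
      using arg_cong[OF 1, of "\<lambda>x. 2 * x"] two by (simp add: algebra_simps)
    ultimately have "2 * (G * (1 - 2 * l)) = l * (2 * l * l' + l - 1)" by algebra
    then have "2 * (G * (1 - 2 * l)) / 2 = l * (2 * l * l' + l - 1) / 2" by simp
    then show ?thesis using two by simp
  qed
  show "g * (1 - 2 * lam) = lam * (2 * lam * lam' + lam - 1) / 2" by (rule field[OF k1 g])
  show "g * (1 - 2 * lam') = lam' * (2 * lam * lam' + lam' - 1) / 2"
  proof -
    have "g = be * (1 - lam') - lam" using gg g'_def by simp
    from field[OF k2 this] show ?thesis by (simp only: mult.commute mult.left_commute mult.assoc)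
  qed
qed

subsection \<open>Three axes of the same type\<close>

lemma scale_two: "(2::'f) *s x = x + x"
  using scale_left_distrib[of 1 1 x] by simp

text \<open>The products are the axis relations of the Matsuo algebra of the symmetric group of
  degree 3. They make \<open>b - c\<close> odd for \<open>a\<close>, which is why the involution
  exchanges \<open>b\<close> and \<open>c\<close>. The vector \<open>s\<close> acts as the scalar
  \<open>g\<close>. It is not redundant: \<open>h * g = 1 + lam\<close>, so for
  \<open>lam = - 1\<close> possibly \<open>h = 0\<close>, and then \<open>a + b + c\<close> does not
  determine \<open>s\<close>.\<close>

lemma triple_axis:
  assumes two: "(2::'f) \<noteq> 0" and lam: "lam \<noteq> 0" "lam \<noteq> 1"
    and idem: "a \<noteq> 0" "a \<odot> a = a" "b \<odot> b = b" "c \<odot> c = c"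
    and prods: "a \<odot> b = (lam / 2) *s (a + b - c)" "a \<odot> c = (lam / 2) *s (a + c - b)"
      "b \<odot> c = (lam / 2) *s (b + c - a)"
    and s: "a \<odot> s = g *s a" "b \<odot> s = g *s b" "c \<odot> s = g *s c" "s \<odot> s = g *s s"
      "a + b + c = h *s s"
    and span: "\<And>u. \<exists>x y z t. u = x *s a + y *s b + z *s c + t *s s"
  shows "primitive_axis_of_type lam a" "tau lam a b = c" "tau lam a c = b" "tau lam a a = a"
    "g \<noteq> 0 \<Longrightarrow> s \<noteq> g *s a \<Longrightarrow> primitive_axis_of_type (1 - lam) ((1 / g) *s s - a)"
proof -
  define w where "w = b - c"
  define f where "f = s - g *s a"
  have bc: "b + c = h *s s - a" using s(5) by (simp add: algebra_simps)
  have half: "(lam / 2) *s (x + x) = lam *s x" for x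
    using two by (simp add: scale_two[symmetric])
  have aw: "a \<odot> w = lam *s w"
  proof -
    have "a \<odot> w = (lam / 2) *s ((b - c) + (b - c))"
      unfolding w_def mult_diff prods by (simp add: scale_right_distrib scale_right_diff_distrib algebra_simps)
    then show ?thesis unfolding half w_def .
  qed
  have af: "a \<odot> f = 0" unfolding f_def by (simp add: mult_linear idem s)
  have sw: "s \<odot> w = g *s w" using s by (simp add: w_def mult_linear mult_commute[of s b] mult_commute[of s c] scale_right_diff_distrib)
  have fw: "f \<odot> w = (g - g * lam) *s w"
    unfolding f_def by (simp add: mult_linear sw aw scale_left_diff_distrib)
  have ff: "f \<odot> f = 0 *s a + g *s f"
    unfolding f_def using s idem by (simp add: mult_linear mult_commute[of s a] scale_right_diff_distrib)
  have hg: "h * g = 1 + lam"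
  proof -
    have "a \<odot> (a + b + c) = a + ((lam / 2) *s (a + b - c) + (lam / 2) *s (a + c - b))"
      by (simp add: mult_linear prods idem)
    also have "\<dots> = a + (lam / 2) *s (a + a)" by (simp add: scale_right_distrib[symmetric])
    finally have "(h * g) *s a = (1 + lam) *s a" unfolding s(5) half by (simp add: mult_linear s scale_left_distrib)
    then show ?thesis using idem(1) by simp
  qed
  have ww: "w \<odot> w = ((1 - lam) * lam + lam) *s a + ((1 - lam) * h) *s f"
  proof -
    have "w \<odot> w = (b + c) - (b \<odot> c + b \<odot> c)"
      unfolding w_def by (simp add: mult_linear mult_commute[of c b] idem)
    also have "b \<odot> c + b \<odot> c = lam *s (b + c - a)"
      unfolding prods using half by (simp add: scale_right_distrib)
    also have "b + c - lam *s (b + c - a) = (1 - lam) *s (b + c) + lam *s a"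
      by (simp add: scale_left_diff_distrib scale_right_distrib scale_right_diff_distrib algebra_simps)
    also have "\<dots> = (1 - lam) *s ((h * g - 1) *s a + h *s f) + lam *s a"
      unfolding bc f_def by (simp add: scale_left_diff_distrib scale_right_diff_distrib)
    finally show ?thesis unfolding hg by (simp add: scale_right_distrib scale_left_distrib)
  qed
  have b: "b = (lam / 2) *s a + (h / 2) *s f + (1 / 2) *s w"
    and c: "c = (lam / 2) *s a + (h / 2) *s f - (1 / 2) *s w"
  proof -
    have "lam *s a + h *s f = (h * g - 1) *s a + h *s (s - g *s a)" by (simp add: hg f_def)
    also have "\<dots> = b + c"
      unfolding bc by (simp add: scale_left_diff_distrib scale_right_diff_distrib)
    finally have 1: "lam *s a + h *s f = b + c" .
    have "b + b = lam *s a + h *s f + w" "c + c = lam *s a + h *s f - w" unfolding 1 w_def by simp_all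
    then have "(1 / 2) *s (2 *s b) = (1 / 2) *s (lam *s a + h *s f + w)"
      "(1 / 2) *s (2 *s c) = (1 / 2) *s (lam *s a + h *s f - w)" by (simp_all add: scale_two)
    then show "b = (lam / 2) *s a + (h / 2) *s f + (1 / 2) *s w"
      "c = (lam / 2) *s a + (h / 2) *s f - (1 / 2) *s w"
      using two by (simp_all add: scale_right_distrib scale_right_diff_distrib)
  qed
  have span': "\<exists>x y z. u = comb3 a f w x y z" for u
  proof -
    obtain x y z t where u: "u = x *s a + y *s b + z *s c + t *s s" using span by blast
    have A: "a = comb3 a f w 1 0 0" and B: "b = comb3 a f w (lam / 2) (h / 2) (1 / 2)"
      and C: "c = comb3 a f w (lam / 2) (h / 2) (- 1 / 2)" and S: "s = comb3 a f w g 1 0"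
      by (simp add: comb3_def) (use b c in \<open>simp_all add: comb3_def f_def\<close>)
    have "u = x *s comb3 a f w 1 0 0 + y *s comb3 a f w (lam / 2) (h / 2) (1 / 2)
       + z *s comb3 a f w (lam / 2) (h / 2) (- 1 / 2) + t *s comb3 a f w g 1 0"
      using u A[symmetric] B[symmetric] C[symmetric] S[symmetric] by simp
    then show ?thesis by (simp only: comb3_linear) blast
  qed
  show ax: "primitive_axis_of_type lam a"
    by (rule axisI[OF lam idem(1,2) af aw ff fw ww span'])
  have t: "tau lam a (x *s a + y *s f + z *s w) = x *s a + y *s f - z *s w" for x y z
    by (rule tau_decomposed[OF lam idem(2)]) (simp_all add: mult_linear af aw mult.commute)
  show "tau lam a b = c" using t[of "lam / 2" "h / 2" "1 / 2"] b c by simp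
  show "tau lam a c = b" using t[of "lam / 2" "h / 2" "- 1 / 2"] b c by simp
  show "tau lam a a = a" using t[of 1 0 0] by simp
  show "primitive_axis_of_type (1 - lam) ((1 / g) *s s - a)" if g: "g \<noteq> 0" and sa: "s \<noteq> g *s a"
  \<comment> \<open>The candidate is the complement \<open>f / g\<close> of \<open>a\<close> in the
    identity \<open>s / g\<close>; it annihilates \<open>a\<close>, and on \<open>w\<close> its
    eigenvalue is the complementary one.\<close>
  proof (rule axisI[where f = a and w = w])
    let ?e = "(1 / g) *s s - a"
    have e: "?e = (1 / g) *s f" using g by (simp add: f_def scale_right_diff_distrib)
    show "1 - lam \<noteq> 0" "1 - lam \<noteq> 1" using lam by auto
    show "?e \<noteq> 0" unfolding e using g sa by (simp add: f_def)
    show "?e \<odot> ?e = ?e" unfolding e using ff g by (simp add: mult_linear)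
    show "?e \<odot> a = 0" unfolding e using af by (simp add: mult_linear mult_commute[of f a])
    show "?e \<odot> w = (1 - lam) *s w" unfolding e using fw g by (simp add: mult_linear diff_divide_distrib)
    show "a \<odot> a = 0 *s ?e + 1 *s a" using idem by simp
    show "a \<odot> w = lam *s w" by (rule aw)
    show "w \<odot> w = ((1 - lam) * h * g) *s ?e + ((1 - lam) * lam + lam) *s a"
      unfolding e ww using g by (simp add: add.commute)
    show "\<exists>x y z. u = comb3 ?e a w x y z" for u
    proof -
      obtain x y z where "u = comb3 a f w x y z" using span' by blast
      then have "u = comb3 ?e a w (y * g) x z" unfolding e using g by (simp add: comb3_def add_ac)
      then show ?thesis by blast
    qed
  qed
qed

text \<open>The constants come from the ansatz \<open>x a + y n \<plusminus> v\<close> for two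
  further axes: \<open>a \<odot> p = (lam / 2) *s (a + p - q)\<close> forces
  \<open>x = lam / 2\<close>, \<open>2 * y * d = 1 + lam\<close> makes \<open>a + p + q\<close> a
  multiple of \<open>d *s a + n\<close>, and the two coefficients of \<open>v \<odot> v\<close> are
  those demanded by \<open>p \<odot> p = p\<close>.\<close>

lemma matsuo_frame:
  assumes two: "(2::'f) \<noteq> 0" and lam: "lam \<noteq> 0" "lam \<noteq> 1"
    and a: "a \<noteq> 0" "a \<odot> a = a" and n: "a \<odot> n = 0" and v: "a \<odot> v = lam *s v" "v \<noteq> 0"
    and nn: "n \<odot> n = d *s n" and nv: "n \<odot> v = (d * (1 - lam)) *s v"
    and vv: "v \<odot> v = (lam / 2 - lam / 2 * (lam / 2)) *s a + m *s n"
    and y: "2 * y * d = 1 + lam" "m = y - y * y * d"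
    and span: "\<And>u. \<exists>x y z. u = comb3 a n v x y z"
  defines "p \<equiv> comb3 a n v (lam / 2) y 1" and "q \<equiv> comb3 a n v (lam / 2) y (- 1)"
  shows "x \<in> {a, p, q} \<Longrightarrow> primitive_axis_of_type lam x"
    "tau lam a p = q"
    "x \<in> {a, p, q} \<Longrightarrow> z \<in> {a, p, q} \<Longrightarrow> \<exists>e\<in>{a, p, q}. tau lam e x = z"
    "d \<noteq> 0 \<Longrightarrow> n \<noteq> 0 \<Longrightarrow> x \<in> {a, p, q} \<Longrightarrow>
       primitive_axis_of_type (1 - lam) (a + (1 / d) *s n - x)"
    "x \<in> {a, p, q} \<Longrightarrow> \<exists>u. tau lam x u \<noteq> u"
proof -
  define l where "l = lam / 2"
  have l: "lam = 2 * l" "lam / 2 = l" using two by (simp_all add: l_def)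
  define s where "s = comb3 a n v d 1 0"
  let ?c = "comb3 a n v"
  have P: "p = ?c l y 1" and Q: "q = ?c l y (- 1)" unfolding p_def q_def l(2) by simp_all
  have mult: "?c x y z \<odot> ?c x' y' z' = ?c (x * x' + z * z' * (l - l * l))
      (d * y * y' + m * (z * z')) (lam * (x * z' + z * x') + d * (1 - lam) * (y * z' + z * y'))" for x y z x' y' z'
    unfolding comb3_mult nn nv vv a n v l(2)
    by (simp add: comb3_def scale_right_distrib scale_left_distrib algebra_simps)
  have as: "?c 1 0 0 \<odot> s = d *s ?c 1 0 0"
    unfolding s_def by (simp only: mult comb3_linear, intro comb3_cong) (simp_all add: algebra_simps)
  have ps: "p \<odot> s = d *s p"
    unfolding s_def P by (simp only: mult comb3_linear, intro comb3_cong) (simp_all add: algebra_simps)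
  have qs: "q \<odot> s = d *s q"
    unfolding s_def Q by (simp only: mult comb3_linear, intro comb3_cong) (simp_all add: algebra_simps)
  have ss: "s \<odot> s = d *s s"
    unfolding s_def by (simp only: mult comb3_linear, intro comb3_cong) (simp_all add: algebra_simps)
  have yd: "2 * y * d = 1 + 2 * l" using y(1) l(1) by simp
  have pp: "p \<odot> p = p"
    unfolding P mult by (intro comb3_cong) ((simp add: algebra_simps; fail) | (use yd y(2) l(1) in algebra))+
  have qq: "q \<odot> q = q"
    unfolding Q mult by (intro comb3_cong) ((simp add: algebra_simps; fail) | (use yd y(2) l(1) in algebra))+
  have ap: "?c 1 0 0 \<odot> p = (lam / 2) *s (?c 1 0 0 + p - q)"
    unfolding l(2) P Q by (simp only: mult comb3_linear, intro comb3_cong) ((simp add: algebra_simps; fail) | (use yd y(2) l(1) in algebra))+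
  have aq: "?c 1 0 0 \<odot> q = (lam / 2) *s (?c 1 0 0 + q - p)"
    unfolding l(2) P Q by (simp only: mult comb3_linear, intro comb3_cong) ((simp add: algebra_simps; fail) | (use yd y(2) l(1) in algebra))+
  have pq: "p \<odot> q = (lam / 2) *s (p + q - ?c 1 0 0)"
    unfolding l(2) P Q by (simp only: mult comb3_linear, intro comb3_cong) ((simp add: algebra_simps; fail) | (use yd y(2) l(1) in algebra))+
  have sum: "?c 1 0 0 + p + q = (2 * y) *s s"
    unfolding s_def P Q by (simp only: mult comb3_linear, intro comb3_cong) ((simp add: algebra_simps; fail) | (use yd y(2) l(1) in algebra))+
  note as = as[unfolded comb3_basis] and ap = ap[unfolded comb3_basis] and aq = aq[unfolded comb3_basis]
    and pq = pq[unfolded comb3_basis] and sum = sum[unfolded comb3_basis]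
  have n_s: "n = s - d *s a" by (simp add: s_def comb3_def)
  have v_pq: "v = (1 / 2) *s (p - q)"
  proof -
    have "p - q = 2 *s v" unfolding P Q comb3_diff by (simp add: comb3_def)
    then show ?thesis using two by simp
  qed
  have span3: "\<exists>x y z t. u = x *s a + y *s p + z *s q + t *s s" for u
  proof -
    obtain x y z where "u = comb3 a n v x y z" using span by blast
    then have "u = x *s a + y *s (s - d *s a) + z *s ((1 / 2) *s (p - q))"
      unfolding n_s[symmetric] v_pq[symmetric] by (simp add: comb3_def)
    then have "u = (x - y * d) *s a + (z / 2) *s p + (- (z / 2)) *s q + y *s s"
      by (simp add: scale_right_diff_distrib scale_left_diff_distrib)
    then show ?thesis by blast
  qed
  have p0: "p \<noteq> 0" "q \<noteq> 0"
    using comb3_eq_iff[OF lam a n v(1), of _ _ _ 0 0 0] v(2) by (auto simp: P Q comb3_basis)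
  have span_p: "\<exists>x y z t. u = x *s p + y *s a + z *s q + t *s s" for u
    using span3[of u] by (metis add.commute)
  have span_q: "\<exists>x y z t. u = x *s q + y *s a + z *s p + t *s s" for u
    using span3[of u] by (metis add.commute add.left_commute)
  have pa: "p \<odot> a = (lam / 2) *s (p + a - q)" and qa: "q \<odot> a = (lam / 2) *s (q + a - p)"
    and qp: "q \<odot> p = (lam / 2) *s (q + p - a)"
    using ap aq pq by (simp_all add: mult_commute add.commute)
  have sum_p: "p + a + q = (2 * y) *s s" and sum_q: "q + a + p = (2 * y) *s s"
    using sum by (simp_all add: add_ac)
  have ta: "primitive_axis_of_type lam a" "tau lam a p = q" "tau lam a q = p" "tau lam a a = a"
    "d \<noteq> 0 \<Longrightarrow> s \<noteq> d *s a \<Longrightarrow> primitive_axis_of_type (1 - lam) ((1 / d) *s s - a)"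
    by (rule triple_axis[OF two lam a pp qq ap aq pq as ps qs ss sum span3]; assumption)+
  have tp: "primitive_axis_of_type lam p" "tau lam p a = q" "tau lam p q = a" "tau lam p p = p"
    "d \<noteq> 0 \<Longrightarrow> s \<noteq> d *s p \<Longrightarrow> primitive_axis_of_type (1 - lam) ((1 / d) *s s - p)"
    by (rule triple_axis[OF two lam p0(1) pp a(2) qq pa pq aq ps as qs ss sum_p span_p]; assumption)+
  have tq: "primitive_axis_of_type lam q" "tau lam q a = p" "tau lam q p = a" "tau lam q q = q"
    "d \<noteq> 0 \<Longrightarrow> s \<noteq> d *s q \<Longrightarrow> primitive_axis_of_type (1 - lam) ((1 / d) *s s - q)"
    by (rule triple_axis[OF two lam p0(2) qq a(2) pp qa qp ap qs as ps ss sum_q span_q]; assumption)+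
  show "tau lam a p = q" by (rule ta)
  have "(1::'f) \<noteq> - 1" using two by (metis one_add_one add_eq_0_iff)
  then have "p \<noteq> q" using comb3_eq_iff[OF lam a n v(1)] v(2) by (simp add: P Q)
  moreover have "a \<noteq> ?c l y z" if "z \<noteq> 0" for z
    using comb3_eq_iff[OF lam a n v(1), of 1 0 0 l y z] v(2) that unfolding comb3_basis by simp
  then have "a \<noteq> p" "a \<noteq> q" unfolding P Q by simp_all
  ultimately show "x \<in> {a, p, q} \<Longrightarrow> \<exists>u. tau lam x u \<noteq> u"
    using ta(2) tp(2) tq(2) by auto metis+
  show "x \<in> {a, p, q} \<Longrightarrow> primitive_axis_of_type lam x" using ta(1) tp(1) tq(1) by auto
  show "x \<in> {a, p, q} \<Longrightarrow> z \<in> {a, p, q} \<Longrightarrow> \<exists>e\<in>{a, p, q}. tau lam e x = z"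
    using ta(2-4) tp(2-4) tq(2-4) by auto
  show "primitive_axis_of_type (1 - lam) (a + (1 / d) *s n - x)"
    if d: "d \<noteq> 0" and n0: "n \<noteq> 0" and x: "x \<in> {a, p, q}"
  proof -
    have "s \<noteq> d *s a" using n_s n0 by auto
    moreover have "s \<noteq> d *s p" "s \<noteq> d *s q"
      using comb3_eq_iff[OF lam a n v(1)] v(2) d by (simp_all add: s_def P Q comb3_scale)
    moreover have "a + (1 / d) *s n = (1 / d) *s s" using d by (simp add: n_s scale_right_diff_distrib)
    ultimately show ?thesis using x d ta(5) tp(5) tq(5) by auto
  qed
qed

section \<open>Idempotents and conjugacy when the type is not one half\<close>

lemma axis_type_unique_tau:
  assumes ax: "primitive_axis_of_type lam e" "primitive_axis_of_type mu e" and u: "tau lam e u \<noteq> u"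
  shows "mu = lam"
proof -
  note D = axisD[OF ax(1)]
  obtain c f w where w: "u = c *s e + f + w" "e \<odot> f = 0" "e \<odot> w = lam *s w"
    using axis_decompose[OF ax(1)] .
  have "w \<noteq> 0" using tau_decomposed[OF D(1,2,4) w(2,3), of c] w(1) u by auto
  then show ?thesis using axis_type_unique[OF ax(2) w(3)] D by blast
qed

text \<open>Passing from \<open>e\<close> to \<open>i - e\<close> replaces the multiplication
  operator L by 1 - L, which changes neither L - L L nor the constant
  \<open>lam * (1 - lam)\<close>.\<close>

lemma tau_identity:
  assumes "is_identity i"
  shows "tau (1 - lam) (i - e) x = tau lam e x" "e \<odot> e = e \<Longrightarrow> tau lam e (i - x) = i - tau lam e x"
proof -
  have i: "i \<odot> z = z" "z \<odot> i = z" for z using assms unfolding is_identity_def by (metis mult_commute)+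
  show "tau (1 - lam) (i - e) x = tau lam e x"
    by (simp add: tau_def mult_diff i mult.commute)
  show "tau lam e (i - x) = i - tau lam e x" if "e \<odot> e = e"
    by (simp add: tau_def mult_diff i that scale_right_diff_distrib)
qed

text \<open>The hypotheses \<open>e\<close> are the coordinate equations of idempotence for
  \<open>comb3 a n v x t z\<close>. For \<open>z \<noteq> 0\<close> the third one becomes linear in
  \<open>x\<close> and \<open>t\<close>, and the quadratic ones then leave
  \<open>z * z = 1\<close>.\<close>

lemma matsuo_idempotents:
  fixes lam d y m k x t z :: 'f
  assumes two: "(2::'f) \<noteq> 0" and half: "lam \<noteq> 1 / 2" and l: "lam = 2 * l" and k: "k = l - l * l"
    and y: "2 * y * d = 1 + lam" "m = y - y * y * d"
    and e: "x * x + k * z * z = x" "d * t * t + m * z * z = t" "2 * lam * x * z + 2 * d * (1 - lam) * t * z = z"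
  shows "d = 0 \<Longrightarrow> (x = 0 \<and> t = 0 \<and> z = 0) \<or> (x = 1 \<and> t = 0 \<and> z = 0) \<or> (x = l \<and> t = y \<and> (z = 1 \<or> z = - 1))"
    "d \<noteq> 0 \<Longrightarrow> (z = 0 \<and> (x = 0 \<or> x = 1) \<and> (t = 0 \<or> t = 1 / d)) \<or> (x = l \<and> t = y \<and> (z = 1 \<or> z = - 1)) \<or>
       (x = 1 - l \<and> t = 1 / d - y \<and> (z = 1 \<or> z = - 1))"
proof -
  have lam2: "2 * lam \<noteq> 1" using half two by (auto simp: field_simps)
  have dbl: "A = B" if "2 * A = 2 * B" for A B :: 'f using that two by simp
  have x0: "x = 0 \<or> x = 1" if "z = 0" using e(1) that by auto
  have sq: "z = 1 \<or> z = - 1" if "z * z = 1" using that by (simp add: square_eq_1_iff)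
  show "(x = 0 \<and> t = 0 \<and> z = 0) \<or> (x = 1 \<and> t = 0 \<and> z = 0) \<or> (x = l \<and> t = y \<and> (z = 1 \<or> z = - 1))" if d: "d = 0"
  proof (cases "z = 0")
    case True
    then show ?thesis using x0 e(2) d by auto
  next
    case False
    have lam: "lam = - 1" using y(1) d by (simp add: add_eq_0_iff)
    \<comment> \<open>The values -1 and 1/2 coincide exactly in characteristic 3.\<close>
    then have "3 \<noteq> (0::'f)" using lam2 by (auto simp: algebra_simps)
    have "z * (2 * lam * x) = z * 1" using e(3) d by (simp add: mult.commute)
    then have "2 * lam * x = 1" using False mult_left_cancel by blast
    then have x: "2 * x = - 1" using lam by algebra
    have l1: "2 * l = - 1" using l lam by simp
    have "3 * (z * z) = 3 * 1" using x l1 e(1) k by algebra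
    then have zz: "z * z = 1" using \<open>3 \<noteq> 0\<close> mult_left_cancel by blast
    moreover have "x = l" using x l1 by - (rule dbl, simp)
    moreover have "t = y" using e(2) y(2) d zz by (simp add: mult.assoc)
    ultimately show ?thesis using sq by blast
  qed
  show "(z = 0 \<and> (x = 0 \<or> x = 1) \<and> (t = 0 \<or> t = 1 / d)) \<or> (x = l \<and> t = y \<and> (z = 1 \<or> z = - 1)) \<or>
       (x = 1 - l \<and> t = 1 / d - y \<and> (z = 1 \<or> z = - 1))" if d: "d \<noteq> 0"
  proof (cases "z = 0")
    case True
    then have "t * (d * t) = t * 1" using e(2) by (simp add: ac_simps)
    then have "t = 0 \<or> d * t = 1" by (metis mult_left_cancel)
    then have "t = 0 \<or> t = 1 / d" using d by (auto simp: field_simps)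
    then show ?thesis using x0 True by blast
  next
    case False
    \<comment> \<open>\<open>Y\<close> is the coordinate along the idempotent \<open>n / d\<close>.
      After this rescaling the second equation has the form of the first, with \<open>D\<close> in
      place of \<open>l\<close>.\<close>
    define Y where "Y = d * t"
    define D where "D = y * d"
    have D: "2 * D = 1 + 2 * l" using y(1) l by (simp add: D_def mult.assoc)
    have "z * (2 * lam * x + 2 * (1 - lam) * Y) = z * 1"
      using e(3) by (simp add: Y_def algebra_simps)
    then have lin: "2 * lam * x + 2 * (1 - lam) * Y = 1" using False mult_left_cancel by blast
    have eY: "Y * Y + (D - D * D) * z * z = Y"
    proof -
      have "d * (d * t * t + m * z * z) = d * t" using e(2) by simp
      then show ?thesis unfolding Y_def D_def y(2) by (simp add: algebra_simps)
    qed
    \<comment> \<open>A parameter on the line \<open>lin\<close>, with origin at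
      \<open>x = Y = 1 / 2\<close>. Completing squares turns the quadratic equations into linear
      relations between \<open>s * s\<close> and \<open>z * z\<close>; subtracting them isolates the
      factor \<open>1 - 2 * lam\<close>, which is where the exclusion of one half enters.\<close>
    define s where "s = 2 * (x - Y)"
    have X: "2 * x - 1 = (1 - 2 * l) * s" using lin l unfolding s_def by algebra
    have YY: "2 * Y - 1 = - 2 * l * s" using lin l unfolding s_def by algebra
    have 1: "(1 - 2 * l)\<^sup>2 * s\<^sup>2 = 1 - z * z * (1 - (1 - 2 * l)\<^sup>2)" using X e(1) k by algebra
    have 2: "4 * l\<^sup>2 * s\<^sup>2 = 1 - z * z * (1 - 4 * l\<^sup>2)" using YY eY D by algebra
    have "(1 - 2 * lam) * s\<^sup>2 = (1 - 2 * lam) * (z * z)" using 1 2 l by algebra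
    then have s: "s\<^sup>2 = z * z" using lam2 by simp
    then have zz: "z * z = 1" using 2 by algebra
    then have "s * s = 1" using s by (simp add: power2_eq_square)
    then consider "s = 1" | "s = - 1" by (auto simp: square_eq_1_iff)
    then show ?thesis
    proof cases
      case 1
      have "x = 1 - l" using X unfolding 1 by - (rule dbl, simp add: algebra_simps)
      moreover have "Y = 1 - D" using YY D unfolding 1 by - (rule dbl, simp add: algebra_simps)
      then have "t = 1 / d - y" using d unfolding Y_def D_def by (simp add: field_simps)
      ultimately show ?thesis using sq[OF zz] by blast
    next
      case 2
      have "x = l" using X unfolding 2 by - (rule dbl, simp add: algebra_simps)
      moreover have "Y = D" using YY D unfolding 2 by - (rule dbl, simp add: algebra_simps)
      then have "t = y" using d unfolding Y_def D_def by (simp add: mult.commute)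
      ultimately show ?thesis using sq[OF zz] by blast
    qed
  qed
qed

lemma matsuo_axes:
  assumes two: "(2::'f) \<noteq> 0" and half: "lam \<noteq> 1 / 2" and lam: "lam \<noteq> 0" "lam \<noteq> 1"
    and a: "a \<noteq> 0" "a \<odot> a = a" and n: "a \<odot> n = 0" and v: "a \<odot> v = lam *s v" "v \<noteq> 0"
    and nn: "n \<odot> n = d *s n" and nv: "n \<odot> v = (d * (1 - lam)) *s v"
    and vv: "v \<odot> v = (lam / 2 - lam / 2 * (lam / 2)) *s a + m *s n"
    and y: "2 * y * d = 1 + lam" "m = y - y * y * d"
    and dn: "n = 0 \<longrightarrow> d = 0"
    and span: "\<And>u. \<exists>x y z. u = comb3 a n v x y z"
  defines "p \<equiv> comb3 a n v (lam / 2) y 1" and "q \<equiv> comb3 a n v (lam / 2) y (- 1)" and "i \<equiv> a + (1 / d) *s n"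
  shows "d = 0 \<Longrightarrow> {e. nontrivial_idempotent e} = {a, p, q}"
    "d \<noteq> 0 \<Longrightarrow> {e. nontrivial_idempotent e} = {a, i - a, p, i - p, q, i - q}"
    "d \<noteq> 0 \<Longrightarrow> is_identity i"
    "d \<noteq> 0 \<Longrightarrow> card {e. nontrivial_idempotent e} = 6"
    "nontrivial_idempotent e \<Longrightarrow> primitive_axis e"
    "primitive_axis_of_type mu c \<Longrightarrow> primitive_axis_of_type mu c' \<Longrightarrow> conjugate c c'"
    "tau lam a p = q"
proof -
  note M = matsuo_frame[OF two lam a n v nn nv vv y span, folded p_def q_def]
  note eq_iff = comb3_eq_iff[OF lam a n v(1)]
  let ?c = "comb3 a n v"
  define l where "l = lam / 2"
  have l: "lam = 2 * l" "lam / 2 = l" using two by (simp_all add: l_def)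
  have P: "p = ?c l y 1" and Q: "q = ?c l y (- 1)" unfolding p_def q_def l(2) by simp_all
  have mult: "?c x y z \<odot> ?c x' y' z' = ?c (x * x' + (l - l * l) * z * z')
      (d * y * y' + m * z * z') (lam * (x * z' + z * x') + d * (1 - lam) * (y * z' + z * y'))" for x y z x' y' z'
    unfolding comb3_mult nn nv vv a n v l(2)
    by (simp add: comb3_def scale_right_distrib scale_left_distrib algebra_simps)
  show "tau lam a p = q" by (rule M)
  have T: "{e. nontrivial_idempotent e} \<supseteq> {a, p, q}"
    using axis_nontrivial[OF M(1) lam a n v(1)] v(2) by auto
  have iT: "i - x \<in> {e. nontrivial_idempotent e}" if "x \<in> {a, p, q}" "d \<noteq> 0" for x
    using axis_nontrivial[OF M(4) lam a n v(1)] v(2) that dn unfolding i_def by auto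
  have idem: "x \<odot> x = x" if "x \<in> {a, p, q}" for x using axisD(4)[OF M(1)[OF that]] .
  have idem_coord: "x * x + (l - l * l) * z * z = x" "d * t * t + m * z * z = t \<or> n = 0" "2 * lam * x * z + 2 * d * (1 - lam) * t * z = z"
    if "?c x t z \<odot> ?c x t z = ?c x t z" for x t z
    using that v(2) unfolding mult eq_iff by (auto simp: algebra_simps)
  show N0: "{e. nontrivial_idempotent e} = {a, p, q}" if d: "d = 0"
  proof (intro equalityI T subsetI)
    fix u assume "u \<in> {e. nontrivial_idempotent e}"
    then have u: "u \<odot> u = u" "u \<noteq> 0" by (auto simp: nontrivial_idempotent_def idempotent_def)
    obtain x t' z where c': "u = ?c x t' z" using span by blast
    \<comment> \<open>If \<open>n = 0\<close>, the middle coordinate is arbitrary; this value makes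
      the second coordinate equation hold for \<open>d = 0\<close>.\<close>
    define t where "t = (if n = 0 then m * z * z else t')"
    have c: "u = ?c x t z" unfolding c' t_def eq_iff by simp
    note I = idem_coord[OF u(1)[unfolded c]]
    have t: "d * t * t + m * z * z = t" using I(2) d by (auto simp: t_def)
    from matsuo_idempotents(1)[OF two half l(1) refl y I(1) t I(3) d]
    show "u \<in> {a, p, q}" using u(2) unfolding c P Q by (auto simp: comb3_basis)
  qed
  have i: "is_identity i" if d: "d \<noteq> 0"
  proof -
    have i: "i = ?c 1 (1 / d) 0" by (simp add: i_def comb3_def)
    have "i \<odot> ?c x y z = ?c x y z" for x y z
      unfolding i mult using d by (intro comb3_cong) (simp_all add: algebra_simps)
    then show ?thesis unfolding is_identity_def using span by metis
  qed
  then show "d \<noteq> 0 \<Longrightarrow> is_identity i" .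
  have coords: "i - a = ?c 0 (1 / d) 0" "i - p = ?c (1 - l) (1 / d - y) (- 1)" "i - q = ?c (1 - l) (1 / d - y) 1" "i = ?c 1 (1 / d) 0"
    by (simp_all add: i_def P Q comb3_def scale_left_diff_distrib algebra_simps)
  show N1: "{e. nontrivial_idempotent e} = {a, i - a, p, i - p, q, i - q}" if d: "d \<noteq> 0"
  proof (intro equalityI subsetI)
    fix u assume "u \<in> {e. nontrivial_idempotent e}"
    then have u: "u \<odot> u = u" "u \<noteq> 0" "u \<noteq> i"
      using i[OF d] by (auto simp: nontrivial_idempotent_def idempotent_def)
    obtain x t z where c: "u = ?c x t z" using span by blast
    note I = idem_coord[OF u(1)[unfolded c]]
    have t: "d * t * t + m * z * z = t" using I(2) d dn by auto
    from matsuo_idempotents(2)[OF two half l(1) refl y I(1) t I(3) d]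
    have "u \<in> {?c 0 0 0, ?c 1 0 0, ?c 0 (1 / d) 0, ?c 1 (1 / d) 0, ?c l y 1, ?c l y (- 1),
      ?c (1 - l) (1 / d - y) 1, ?c (1 - l) (1 / d - y) (- 1)}" unfolding c by auto
    then show "u \<in> {a, i - a, p, i - p, q, i - q}"
      using u(2,3) unfolding coords(1-3) unfolding coords(4) P Q comb3_basis by blast
  next
    fix u assume "u \<in> {a, i - a, p, i - p, q, i - q}"
    then show "u \<in> {e. nontrivial_idempotent e}" using T iT d by blast
  qed
  have neg1: "(1::'f) \<noteq> - 1" using two by (metis one_add_one add_eq_0_iff)
  show "card {e. nontrivial_idempotent e} = 6" if d: "d \<noteq> 0"
  proof -
    have "l \<noteq> 1 - l" using lam(2) l(1) by (auto simp: algebra_simps)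
    moreover have "n \<noteq> 0" using d dn by blast
    ultimately have "distinct [?c 1 0 0, ?c 0 (1 / d) 0, ?c l y 1, ?c (1 - l) (1 / d - y) (- 1),
        ?c l y (- 1), ?c (1 - l) (1 / d - y) 1]"
      using neg1 neg1[symmetric] v(2) d by (simp add: eq_iff)
    then have "distinct [a, i - a, p, i - p, q, i - q]"
      unfolding coords(1-3) unfolding P Q comb3_basis .
    from distinct_card[OF this] show ?thesis unfolding N1[OF d] by simp
  qed
  show "primitive_axis e" if e: "nontrivial_idempotent e"
  proof (cases "d = 0")
    case True
    then show ?thesis using N0 M(1) e unfolding primitive_axis_def by blast
  next
    case False
    then have "n \<noteq> 0" using dn by blast
    have "e \<in> {a, p, q} \<or> (\<exists>x\<in>{a, p, q}. e = i - x)" using N1[OF False] e by blast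
    then show ?thesis using M(1) M(4)[OF False \<open>n \<noteq> 0\<close>] unfolding primitive_axis_def i_def by blast
  qed
  show "conjugate c c'" if c: "primitive_axis_of_type mu c" "primitive_axis_of_type mu c'"
  proof -
    have N: "nontrivial_idempotent c" "nontrivial_idempotent c'"
      using axis_nontrivial[OF c(1) lam a n v(1)] axis_nontrivial[OF c(2) lam a n v(1)] v(2) by blast+
    have ty: "mu = lam" if "primitive_axis_of_type mu x" "x \<in> {a, p, q}" for x
      using axis_type_unique_tau[OF M(1) that(1)] M(5) that(2) by blast
    have ty': "mu = 1 - lam" if t: "primitive_axis_of_type mu (i - x)" "x \<in> {a, p, q}" "d \<noteq> 0" for x
    proof -
      obtain u where "tau lam x u \<noteq> u" using M(5)[OF t(2)] by blast
      then have "tau (1 - lam) (i - x) u \<noteq> u" by (simp add: tau_identity(1)[OF i[OF t(3)]])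
      then show ?thesis using axis_type_unique_tau[OF _ t(1)] M(4)[OF t(3) _ t(2)] dn t(3) unfolding i_def by blast
    qed
    have cc: "x \<in> {a, p, q} \<or> (d \<noteq> 0 \<and> (\<exists>u\<in>{a, p, q}. x = i - u))" if "nontrivial_idempotent x" for x
      using N0 N1 that by (cases "d = 0") blast+
    \<comment> \<open>The triple has type \<open>lam\<close> and its complements have type
      \<open>1 - lam\<close>, so two axes of equal type lie on the same side. Complements are
      exchanged by the involutions that exchange their partners, since these fix the
      identity.\<close>
    have ne: "lam \<noteq> 1 - lam" using half two by (auto simp: field_simps)
    show ?thesis
    proof (cases "c \<in> {a, p, q}")
      case True
      then have "mu = lam" using ty c by blast
      then have c': "c' \<in> {a, p, q}" using cc[OF N(2)] ty' c(2) ne by blast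
      obtain e where e: "e \<in> {a, p, q}" "tau lam e c = c'" using M(3)[OF True c'] by (rule bexE)
      show ?thesis by (rule conjugateI[OF M(1)[OF e(1)] e(2)])
    next
      case False
      then obtain u where u: "u \<in> {a, p, q}" "c = i - u" and d: "d \<noteq> 0" using cc[OF N(1)] by blast
      then have "mu = 1 - lam" using ty' c(1) by blast
      then have "c' \<notin> {a, p, q}" using ty[OF c(2)] ne by auto
      then obtain u' where u': "u' \<in> {a, p, q}" "c' = i - u'" using cc[OF N(2)] by blast
      obtain e where e: "e \<in> {a, p, q}" "tau lam e u = u'" using M(3)[OF u(1) u'(1)] by (rule bexE)
      have "tau lam e c = c'" unfolding u(2) u'(2) tau_identity(2)[OF i[OF d] idem[OF e(1)]] e(2) ..
      then show ?thesis by (rule conjugateI[OF M(1)[OF e(1)]])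
    qed
  qed
qed

subsection \<open>Axes of type one half\<close>

lemma half_not_0_1:
  assumes "(2::'f) \<noteq> 0"
  shows "1 / 2 \<noteq> (0::'f)" "1 / 2 \<noteq> (1::'f)"
proof -
  show "1 / 2 \<noteq> (0::'f)" using assms by simp
  show "1 / 2 \<noteq> (1::'f)"
  proof
    assume "1 / 2 = (1::'f)"
    then have "(1::'f) = 1 + 1" using assms by (simp add: field_simps)
    then show False by (metis add_cancel_right_right one_neq_zero)
  qed
qed

text \<open>Idempotence of a nonzero \<open>comb3 a n v x y z\<close> forces \<open>x = 1\<close>
  and makes the \<open>n\<close>-part the square of \<open>z\<close>: the idempotents form a
  parabola, or a line if \<open>n = 0\<close>. On the parameter each involution is the point
  reflection at \<open>r\<close>.\<close>

lemma parabola_axis: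
  assumes two: "(2::'f) \<noteq> 0" and a: "a \<noteq> 0" "a \<odot> a = a" and n: "a \<odot> n = 0" and v: "a \<odot> v = (1 / 2) *s v" "v \<noteq> 0"
    and tab: "n \<odot> n = 0" "n \<odot> v = 0" "v \<odot> v = n"
    and span: "\<And>u. \<exists>x y z. u = comb3 a n v x y z"
  shows "primitive_axis_of_type (1 / 2) (comb3 a n v 1 (r\<^sup>2) r)"
    "tau (1 / 2) (comb3 a n v 1 (r\<^sup>2) r) (comb3 a n v 1 (t\<^sup>2) t) = comb3 a n v 1 ((2 * r - t)\<^sup>2) (2 * r - t)"
    "{e. nontrivial_idempotent e} = {comb3 a n v 1 (r\<^sup>2) r | r. True}"
proof -
  define h where "h = (1 / 2 :: 'f)"
  have h: "2 * h = 1" "1 / 2 = h" using two by (simp_all add: h_def)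
  have lam: "h \<noteq> 0" "h \<noteq> 1" unfolding h_def using half_not_0_1[OF two] by blast+
  let ?c = "comb3 a n v"
  have av: "a \<odot> v = h *s v" using v(1) h by simp
  note eq_iff = comb3_eq_iff[OF lam a n av]
  have mult: "?c x y z \<odot> ?c x' y' z' = ?c (x * x') (z * z') (h * (x * z' + z * x'))" for x y z x' y' z'
    unfolding comb3_mult tab a n av
    by (simp add: comb3_def scale_right_distrib scale_left_distrib algebra_simps)
  define e where "e r = ?c 1 (r\<^sup>2) r" for r
  \<comment> \<open>The odd vector of \<open>e r\<close> is the tangent of the parabola, the
    derivative of \<open>e r\<close> in \<open>r\<close>. The decomposition of \<open>e t\<close>
    used below is its Taylor expansion at \<open>r\<close>.\<close>
  define w where "w r = ?c 0 (2 * r) 1" for r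
  have ee: "e r \<odot> e r = e r" for r
    unfolding e_def mult by (intro comb3_cong) ((simp add: power2_eq_square algebra_simps; fail) | (use h(1) in algebra))+
  have N: "n = ?c 0 1 0" by (simp add: comb3_def)
  have en: "e r \<odot> n = 0" and wn: "n \<odot> w r = 0 *s w r" for r
  proof -
    have "e r \<odot> ?c 0 1 0 = ?c 0 0 0" "?c 0 1 0 \<odot> w r = ?c 0 0 0" unfolding e_def w_def mult by simp_all
    then show "e r \<odot> n = 0" "n \<odot> w r = 0 *s w r" unfolding comb3_basis by simp_all
  qed
  have ew: "e r \<odot> w r = h *s w r" for r
    unfolding e_def w_def mult comb3_linear
    by (intro comb3_cong) ((simp add: power2_eq_square algebra_simps; fail) | (use h(1) in algebra))+
  have ww: "w r \<odot> w r = 0 *s e r + 1 *s n" for r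
  proof -
    have "w r \<odot> w r = ?c 0 1 0" unfolding w_def mult by simp
    then show ?thesis unfolding comb3_basis by simp
  qed
  have e0: "e r \<noteq> 0" for r using eq_iff[of 1 "r\<^sup>2" r 0 0 0] by (simp add: e_def comb3_basis)
  have span': "\<exists>x y z. u = comb3 (e r) n (w r) x y z" for u r
  proof -
    obtain x y z where u: "u = ?c x y z" using span by blast
    have "u = x *s e r + (y - x * r\<^sup>2 - 2 * r * (z - x * r)) *s ?c 0 1 0 + (z - x * r) *s w r"
      unfolding u e_def w_def comb3_linear by (intro comb3_cong) (simp_all add: algebra_simps)
    then show ?thesis unfolding comb3_basis by (auto simp: comb3_def)
  qed
  have ax: "primitive_axis_of_type h (e r)" for r
    by (rule axisI[where ?c1.0 = 0 and ?c2.0 = 0, OF lam e0 ee en ew _ wn ww span']) (simp add: tab)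
  show "primitive_axis_of_type (1 / 2) (?c 1 (r\<^sup>2) r)" using ax unfolding e_def h .
  have t1: "tau h (e r) (1 *s e r + (t - r)\<^sup>2 *s n + (t - r) *s w r) = 1 *s e r + (t - r)\<^sup>2 *s n - (t - r) *s w r"
    by (rule tau_decomposed[OF lam ee]) (simp_all add: mult_linear en ew mult.commute)
  have t2: "1 *s e r + (t - r)\<^sup>2 *s ?c 0 1 0 + (t - r) *s w r = e t"
    unfolding e_def w_def comb3_linear by (intro comb3_cong) (simp_all add: power2_eq_square algebra_simps)
  have t3: "1 *s e r + (t - r)\<^sup>2 *s ?c 0 1 0 - (t - r) *s w r = e (2 * r - t)"
    unfolding e_def w_def comb3_linear
    by (intro comb3_cong) ((simp add: power2_eq_square algebra_simps; fail) | algebra)+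
  show "tau (1 / 2) (?c 1 (r\<^sup>2) r) (?c 1 (t\<^sup>2) t) = ?c 1 ((2 * r - t)\<^sup>2) (2 * r - t)"
    using t1[unfolded t2[unfolded comb3_basis] t3[unfolded comb3_basis]] unfolding e_def h .
  show "{e. nontrivial_idempotent e} = {?c 1 (r\<^sup>2) r | r. True}"
  proof (intro equalityI subsetI)
    fix u assume "u \<in> {e. nontrivial_idempotent e}"
    then have u: "u \<odot> u = u" "u \<noteq> 0" by (auto simp: nontrivial_idempotent_def idempotent_def)
    obtain x y z where c: "u = ?c x y z" using span by blast
    have q: "x * x = x" "z * z = y \<or> n = 0" "h * (x * z + z * x) = z"
      using u(1) unfolding c mult eq_iff using v(2) by auto
    have "x = 1"
    proof (rule ccontr)
      assume "x \<noteq> 1"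
      then have x: "x = 0" using q(1) by simp
      then have z: "z = 0" using q(3) by simp
      then have "?c x y z = 0" using x q(2) by (auto simp: comb3_def)
      then show False using u(2) c by simp
    qed
    moreover have "?c 1 y z = ?c 1 (z\<^sup>2) z" using q(2) unfolding eq_iff by (auto simp: power2_eq_square)
    ultimately show "u \<in> {?c 1 (r\<^sup>2) r | r. True}" using c by auto
  next
    fix u assume "u \<in> {?c 1 (r\<^sup>2) r | r. True}"
    then obtain r where "u = e r" by (auto simp: e_def)
    then show "u \<in> {e. nontrivial_idempotent e}"
      using axis_nontrivial[OF ax lam a n av] v(2) by simp
  qed
qed

text \<open>With \<open>s = a - f\<close> the nontrivial idempotents are \<open>(1 + (2 x - 1) s + 2 z v) / 2\<close>, and \<open>tau\<close> is the
  reflection in \<open>(2 x - 1) s + 2 z v\<close> for the quadratic form \<open>P s + Q v \<mapsto> P\<^sup>2 + k Q\<^sup>2\<close>.\<close>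

lemma spin_axis:
  assumes two: "(2::'f) \<noteq> 0" and a: "a \<noteq> 0" "a \<odot> a = a" and f: "a \<odot> f = 0" "f \<noteq> 0" and v: "a \<odot> v = (1 / 2) *s v" "v \<noteq> 0"
    and tab: "f \<odot> f = f" "f \<odot> v = (1 / 2) *s v" "v \<odot> v = k *s a + k *s f"
    and span: "\<And>u. \<exists>x y z. u = comb3 a f v x y z"
  defines "E \<equiv> \<lambda>x z. comb3 a f v x (1 - x) z"
  shows "z\<^sup>2 * k = x * (1 - x) \<Longrightarrow> primitive_axis_of_type (1 / 2) (E x z)"
    "z\<^sup>2 * k = x * (1 - x) \<Longrightarrow> W = (p - q) * (2 * x - 1) + 4 * k * r * z \<Longrightarrow>
       tau (1 / 2) (E x z) (comb3 a f v p q r) =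
         comb3 a f v (q + W * (2 * x - 1)) (p - W * (2 * x - 1)) (2 * W * z - r)"
    "{e. nontrivial_idempotent e} = {E x z | x z. z\<^sup>2 * k = x * (1 - x)}"
    "is_identity (a + f)"
    "primitive_axis_of_type mu e \<Longrightarrow> mu = 1 / 2 \<and> (\<exists>x z. e = E x z \<and> z\<^sup>2 * k = x * (1 - x))"
proof -
  define h where "h = (1 / 2 :: 'f)"
  have h: "2 * h = 1" "1 / 2 = h" using two by (simp_all add: h_def)
  have lam: "h \<noteq> 0" "h \<noteq> 1" unfolding h_def using half_not_0_1[OF two] by blast+
  have dbl: "A = B" if "2 * A = 2 * B" for A B :: 'f using that two by simp
  have half: "h * A = B" if "A = 2 * B" for A B 
  proof -
    have "h * A = (2 * h) * B" unfolding that by (simp only: mult.commute mult.left_commute)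
    then show ?thesis unfolding h by simp
  qed
  let ?c = "comb3 a f v"
  have av: "a \<odot> v = h *s v" using v(1) h by simp
  have fv: "f \<odot> v = h *s v" using tab h by simp
  note eq_iff = comb3_eq_iff[OF lam a f(1) av]
  have mult: "?c x y z \<odot> ?c x' y' z' = ?c (x * x' + k * z * z') (y * y' + k * z * z') (h * ((x + y) * z' + z * (x' + y')))" for x y z x' y' z'
    unfolding comb3_mult tab(1,3) fv a f(1) av
    by (simp add: comb3_def scale_right_distrib scale_left_distrib algebra_simps)
  have mult_basis: "?c x y z \<odot> ?c x' y' z' = ?c x'' y'' z''"
    if "x * x' + k * z * z' = x''" "y * y' + k * z * z' = y''" "(x + y) * z' + z * (x' + y') = 2 * z''"
    for x y z x' y' z' x'' y'' z''
    unfolding mult by (intro comb3_cong that half)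
  \<comment> \<open>With \<open>s = a - f\<close> this is \<open>2 k z s + (1 - 2 x) v\<close>,
    which is orthogonal to \<open>(2 x - 1) s + 2 z v\<close> for the quadratic form.\<close>
  define w where "w x z = ?c (2 * k * z) (- 2 * k * z) (1 - 2 * x)" for x z
  have id: "is_identity (a + f)"
  proof -
    have "a + f = ?c 1 1 0" by (simp add: comb3_def)
    moreover have "?c 1 1 0 \<odot> ?c x y z = ?c x y z" for x y z by (rule mult_basis) simp_all
    ultimately show ?thesis unfolding is_identity_def using span by metis
  qed
  show "is_identity (a + f)" by (rule id)
  have E0: "E x z \<noteq> 0" for x z
  proof
    assume "E x z = 0"
    then have "?c x (1 - x) z = ?c 0 0 0" unfolding E_def comb3_basis .
    then show False unfolding eq_iff using f by auto
  qed
  have w0: "w x z \<noteq> 0" if "z\<^sup>2 * k = x * (1 - x)" for x z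
  proof
    assume "w x z = 0"
    then have "?c (2 * k * z) (- 2 * k * z) (1 - 2 * x) = ?c 0 0 0" unfolding w_def comb3_basis .
    then have *: "2 * k * z = 0" "1 - 2 * x = 0" unfolding eq_iff using v by auto
    have "2 * (z\<^sup>2 * k) = 0" using *(1) two by auto
    then have "2 * x * (2 * (1 - x)) = 0" using that two by auto
    moreover have "2 * x = 1" "2 * (1 - x) = 1" using *(2) by (simp_all add: algebra_simps)
    ultimately show False by simp
  qed
  have EE: "E x z \<odot> E x z = E x z" if "z\<^sup>2 * k = x * (1 - x)" for x z
    unfolding E_def by (rule mult_basis) ((simp add: algebra_simps; fail) | (use that in algebra))+
  have Ef: "E x z \<odot> E (1 - x) (- z) = 0" if "z\<^sup>2 * k = x * (1 - x)" for x z
  proof -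
    have "E x z \<odot> E (1 - x) (- z) = ?c 0 0 0"
      unfolding E_def by (rule mult_basis) ((simp add: algebra_simps; fail) | (use that in algebra))+
    then show ?thesis unfolding comb3_basis .
  qed
  have hw: "h *s w x z = ?c (k * z) (- k * z) (h * (1 - 2 * x))" for x z
    unfolding w_def comb3_scale by (rule comb3_cong[OF half half refl]) simp_all
  have Ew: "E x z \<odot> w x z = h *s w x z" for x z
    unfolding E_def hw unfolding w_def mult
    by (intro comb3_cong) (simp_all add: algebra_simps)
  have fw: "E (1 - x) (- z) \<odot> w x z = h *s w x z" for x z
    unfolding E_def hw unfolding w_def mult
    by (intro comb3_cong) (simp_all add: algebra_simps)
  have ww: "w x z \<odot> w x z = k *s E x z + k *s E (1 - x) (- z)" if "z\<^sup>2 * k = x * (1 - x)" for x z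
    unfolding E_def comb3_linear unfolding w_def
    by (rule mult_basis) ((simp add: algebra_simps; fail) | (use that in algebra))+
  \<comment> \<open>\<open>E x z\<close> and \<open>E (1 - x) (- z)\<close> add up to the identity,
    so their coefficients add up to \<open>p + q\<close>. Their difference is \<open>W\<close>,
    twice the inner product of the part of the vector in the span of \<open>s = a - f\<close> and
    \<open>v\<close> with the norm 1 vector of \<open>E x z\<close>.\<close>
  define S where "S p q W = h * (p + q + W)" for p q W
  have S: "2 * S p q W = p + q + W" for p q W
  proof -
    have "2 * S p q W = (2 * h) * (p + q + W)" unfolding S_def by (simp only: mult.assoc)
    then show ?thesis unfolding h by simp
  qed
  have dec: "?c p q r = S p q W *s E x z + (S p q W - W) *s E (1 - x) (- z) + ((p - q) * z - r * (2 * x - 1)) *s w x z"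
    and tau_dec: "S p q W *s E x z + (S p q W - W) *s E (1 - x) (- z) - ((p - q) * z - r * (2 * x - 1)) *s w x z
      = ?c (q + W * (2 * x - 1)) (p - W * (2 * x - 1)) (2 * W * z - r)"
    if xz: "z\<^sup>2 * k = x * (1 - x)" and W: "W = (p - q) * (2 * x - 1) + 4 * k * r * z" for p q r x z W
  proof -
    show "?c p q r = S p q W *s E x z + (S p q W - W) *s E (1 - x) (- z) + ((p - q) * z - r * (2 * x - 1)) *s w x z"
      unfolding E_def w_def comb3_linear by (intro comb3_cong; rule dbl) ((simp add: algebra_simps; fail) | (use S[of p q W] xz W in algebra))+
    show "S p q W *s E x z + (S p q W - W) *s E (1 - x) (- z) - ((p - q) * z - r * (2 * x - 1)) *s w x z
      = ?c (q + W * (2 * x - 1)) (p - W * (2 * x - 1)) (2 * W * z - r)"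
      unfolding E_def w_def comb3_linear by (intro comb3_cong; rule dbl) ((simp add: algebra_simps; fail) | (use S[of p q W] xz W in algebra))+
  qed
  have ax: "primitive_axis_of_type h (E x z)" if xz: "z\<^sup>2 * k = x * (1 - x)" for x z
  proof (rule axisI[OF lam E0 EE[OF xz] Ef[OF xz] Ew _ fw ww[OF xz]])
    have "E (1 - x) (- z) \<odot> E (1 - x) (- z) = E (1 - x) (- z)" by (rule EE) (use xz in \<open>simp add: mult.commute\<close>)
    then show "E (1 - x) (- z) \<odot> E (1 - x) (- z) = 0 *s E x z + 1 *s E (1 - x) (- z)" by simp
    show "\<exists>c d g. u = comb3 (E x z) (E (1 - x) (- z)) (w x z) c d g" for u
    proof -
      obtain p q r where "u = ?c p q r" using span by blast
      then show ?thesis using dec[OF xz refl] unfolding comb3_def by blast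
    qed
  qed
  show "z\<^sup>2 * k = x * (1 - x) \<Longrightarrow> primitive_axis_of_type (1 / 2) (E x z)" using ax unfolding h .
  show "tau (1 / 2) (E x z) (?c p q r) = ?c (q + W * (2 * x - 1)) (p - W * (2 * x - 1)) (2 * W * z - r)"
    if xz: "z\<^sup>2 * k = x * (1 - x)" and W: "W = (p - q) * (2 * x - 1) + 4 * k * r * z"
    unfolding dec[OF xz W] tau_dec[OF xz W, symmetric] h
    by (rule tau_decomposed[OF lam EE[OF xz]]) (simp_all add: mult_linear Ef[OF xz] Ew mult.commute)
  show N: "{e. nontrivial_idempotent e} = {E x z | x z. z\<^sup>2 * k = x * (1 - x)}"
  proof (intro equalityI subsetI)
    fix u assume "u \<in> {e. nontrivial_idempotent e}"
    then have u: "u \<odot> u = u" "u \<noteq> 0" "u \<noteq> a + f"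
      using id by (auto simp: nontrivial_idempotent_def idempotent_def)
    obtain x y z where c: "u = ?c x y z" using span by blast
    have q: "x * x + k * z * z = x" "y * y + k * z * z = y" "h * ((x + y) * z + z * (x + y)) = z"
      using u(1) unfolding c mult eq_iff using v(2) f(2) by auto
    have xy: "x + y = 1"
    proof (cases "z = 0")
      case True
      have "\<not> (x = 0 \<and> y = 0)" "\<not> (x = 1 \<and> y = 1)" using u(2,3) unfolding c True by (auto simp: comb3_def)
      then show ?thesis using q(1,2) True by auto
    next
      case False
      have "h * ((x + y) * z + z * (x + y)) = (x + y) * z" by (rule half) simp
      then have "(x + y) * z = 1 * z" using q(3) by (simp only: mult_1)
      then show ?thesis using False mult_right_cancel by blast
    qed
    then have "E x z = u" unfolding E_def c by (intro comb3_cong) (auto simp: algebra_simps)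
    moreover have "z\<^sup>2 * k = x * (1 - x)"
    proof -
      have "k * z * z = x - x * x" using q(1) by (metis add_diff_cancel_left')
      then show ?thesis by (simp add: power2_eq_square algebra_simps)
    qed
    ultimately show "u \<in> {E x z | x z. z\<^sup>2 * k = x * (1 - x)}" by blast
  next
    fix u assume "u \<in> {E x z | x z. z\<^sup>2 * k = x * (1 - x)}"
    then show "u \<in> {e. nontrivial_idempotent e}"
      using axis_nontrivial[OF ax lam a f(1) av] v(2) by blast
  qed
  show "mu = 1 / 2 \<and> (\<exists>x z. e = E x z \<and> z\<^sup>2 * k = x * (1 - x))" if e: "primitive_axis_of_type mu e"
  proof -
    have "nontrivial_idempotent e" using axis_nontrivial[OF e lam a f(1) av] v(2) by blast
    then obtain x z where "e = E x z" "z\<^sup>2 * k = x * (1 - x)" using N by blast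
    moreover from this have "mu = h" using axis_type_unique[OF e] Ew w0 lam by blast
    ultimately show ?thesis using h by blast
  qed
qed

end

subsection \<open>Algebras generated by two axes\<close>

locale axis_pair = comm_algebra scale mult
  for scale :: "'f::field \<Rightarrow> 'a::ab_group_add \<Rightarrow> 'a" (infixr "*s" 75)
    and mult :: "'a \<Rightarrow> 'a \<Rightarrow> 'a" (infixl "\<odot>" 70) +
  fixes lam lam' al g :: 'f and a b n v s :: 'a
  assumes two: "(2::'f) \<noteq> 0"
    and gen: "generated_subalgebra {a, b} = UNIV"
    and axis_a: "primitive_axis_of_type lam a"
    and axis_b: "primitive_axis_of_type lam' b"
    and b: "b = al *s a + n + v"
    and n: "a \<odot> n = 0"
    and v: "a \<odot> v = lam *s v"
    and s: "s = a \<odot> b - lam' *s a - lam *s b"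
    and g: "g = al * (1 - lam) - lam'"
begin

abbreviation "Idem \<equiv> {e. nontrivial_idempotent e}"

lemmas Da = axisD[OF axis_a] and Db = axisD[OF axis_b]

lemmas eq_iff = comb3_eq_iff[OF Da n v]

lemma s_eq: "s = g *s a - lam *s n"
  unfolding s g by (rule sigma_eq[OF axis_a b n v])

lemma a_mult_b: "a \<odot> b = al *s a + lam *s v"
  unfolding b using Da n v by (simp add: mult_linear)

lemma b_comb3: "b = comb3 a n v al 1 1"
  by (simp add: b comb3_def)

text \<open>Without odd part \<open>a \<odot> b\<close> is a multiple of \<open>a\<close>, so the
  axes are equal or orthogonal. The algebra is then a line or a direct sum of two lines.\<close>

lemma zero_odd_part_cases:
  assumes "v = 0"
  shows "(a = b \<and> al = 1 \<and> n = 0) \<or> (a \<noteq> b \<and> a \<odot> b = 0 \<and> al = 0 \<and> n = b)"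
proof (cases "a = b")
  case True
  then have "comb3 a n v 1 0 0 = comb3 a n v al 1 1" using b_comb3 by (simp add: comb3_basis)
  then show ?thesis using True unfolding eq_iff by auto
next
  case False
  have ab: "a \<odot> b = al *s a" using a_mult_b assms by simp
  then have "a \<odot> b = 0" using axes_without_odd_part[OF axis_a axis_b] False by blast
  moreover from this have "al = 0" using ab Da by simp
  ultimately show ?thesis using False b assms by simp
qed

lemma equal_axes:
  assumes "a = b"
  shows "dim (UNIV :: 'a set) = 1" "Idem = {}" "primitive_axis_of_type mu c \<Longrightarrow> c = a" "conjugate a a"
proof -
  have "{comb3 a 0 0 x y z | x y z. True} = UNIV"
  proof (rule comb3_generates[OF gen refl])
    let ?C = "{comb3 a 0 0 x y z | x y z. True}"
    have C: "u \<in> ?C" if "u = comb3 a 0 0 x y z" for u x y z using that by blast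
    show "{a, b} \<subseteq> ?C" using C[of a 1 0 0] assms by (simp add: comb3_def)
    show "a \<odot> a \<in> ?C" using C[of _ 1 0 0] Da by (simp add: comb3_def)
  qed (use comb3_basis(4) in \<open>simp; metis\<close>)+
  then have span: "\<exists>x y z. u = comb3 a 0 0 x y z" for u by blast
  have "a \<odot> 0 = 0" "a \<odot> 0 = lam *s 0" by simp_all
  from dim_eigenbasis[OF Da this span] show "dim (UNIV :: 'a set) = 1" by simp
  have u: "\<exists>c. u = c *s a" for u using span[of u] by (auto simp: comb3_def)
  have id: "is_identity a"
    unfolding is_identity_def using u Da by (metis mult_scale_right)
  have idem: "e = 0 \<or> e = a" if e: "e \<odot> e = e" for e
  proof -
    obtain c where c: "e = c *s a" using u by blast
    have "(c * c - c) *s a = 0" using e Da unfolding c by (simp add: mult_linear scale_left_diff_distrib)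
    then have "c * (c - 1) = 0" using Da by (simp add: algebra_simps)
    then show ?thesis using c by auto
  qed
  then show "Idem = {}" using id by (auto simp: nontrivial_idempotent_def idempotent_def)
  show "c = a" if "primitive_axis_of_type mu c" using idem axisD[OF that] by blast
  show "conjugate a a" by (rule conjugateI[OF axis_a]) (simp add: tau_def Da)
qed

text \<open>Multiplication is componentwise here. An axis is a nontrivial idempotent, hence
  \<open>a\<close> or \<open>b\<close>; it has no eigenvalue besides 0 and 1 and so moves nothing,
  whatever type is assigned to it.\<close>

lemma orthogonal_axes:
  assumes ne: "a \<noteq> b" and ab: "a \<odot> b = 0"
  shows "dim (UNIV :: 'a set) = 2" "Idem = {a, b}" "is_identity (a + b)"
    "primitive_axis_of_type mu e \<Longrightarrow> d \<in> {a, b} \<Longrightarrow> tau mu e d = d"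
proof -
  have "{comb3 a b 0 x y z | x y z. True} = UNIV"
  proof (rule comb3_generates[OF gen refl])
    let ?C = "{comb3 a b 0 x y z | x y z. True}"
    have C: "u \<in> ?C" if "u = comb3 a b 0 x y z" for u x y z using that by blast
    show "{a, b} \<subseteq> ?C" using C[of a 1 0 0] C[of b 0 1 0] by (simp add: comb3_def)
    show "a \<odot> a \<in> ?C" "b \<odot> b \<in> ?C" using C[of _ 1 0 0] C[of _ 0 1 0] Da Db by (simp_all add: comb3_def)
    show "a \<odot> b \<in> ?C" unfolding ab by (rule C[of _ 0 0 0]) (simp add: comb3_def)
  qed (use comb3_basis(4) in \<open>simp; metis\<close>)+
  then have span: "\<exists>x y z. u = comb3 a b 0 x y z" for u by blast
  have z: "a \<odot> 0 = lam *s 0" by simp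
  from dim_eigenbasis[OF Da ab z span] show "dim (UNIV :: 'a set) = 2" using Db by simp
  note eq = comb3_eq_iff[OF Da ab z]
  have mult: "comb3 a b 0 x y z \<odot> comb3 a b 0 x' y' z' = comb3 a b 0 (x * x') (y * y') 0" for x y z x' y' z'
    unfolding comb3_mult ab using Da Db by (simp add: comb3_def)
  show id: "is_identity (a + b)"
  proof -
    have "a + b = comb3 a b 0 1 1 0" by (simp add: comb3_def)
    moreover have "comb3 a b 0 1 1 0 \<odot> comb3 a b 0 x y z = comb3 a b 0 x y z" for x y z
      unfolding mult eq by simp
    ultimately show ?thesis unfolding is_identity_def using span by metis
  qed
  have nt: "nontrivial_idempotent e" if "primitive_axis_of_type mu e" for mu e
    using axis_nontrivial[OF that Da ab z] Db by blast
  show N: "Idem = {a, b}"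
  proof (intro equalityI subsetI)
    fix u assume "u \<in> Idem"
    then have u: "u \<odot> u = u" "u \<noteq> 0" "u \<noteq> a + b" using id by (auto simp: nontrivial_idempotent_def idempotent_def)
    obtain x y z where c: "u = comb3 a b 0 x y z" using span by blast
    have "x = 0 \<or> x = 1" "y = 0 \<or> y = 1" using u(1) Db unfolding c mult eq by auto
    then show "u \<in> {a, b}" using u(2,3) unfolding c comb3_def by auto
  qed (use nt axis_a axis_b in auto)
  show "tau mu e d = d" if "primitive_axis_of_type mu e" "d \<in> {a, b}"
  proof -
    have "e \<in> {a, b}" using nt[OF that(1)] N by blast
    then have "e \<odot> d - e \<odot> (e \<odot> d) = 0" using that(2) ab Da Db by (auto simp: mult_commute[of b a])
    then show ?thesis unfolding tau_def by simp
  qed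
qed

text \<open>Chosen so that \<open>s = - lam *s (d *s a + n)\<close>. It vanishes exactly when
  \<open>g\<close> does; otherwise \<open>n / d\<close> is the complement of \<open>a\<close> in the
  identity.\<close>

definition "d = - g / lam"

context
  assumes v0: "v \<noteq> 0"
begin

lemmas table = two_axes_table[OF axis_a axis_b two gen b n v v0 g, folded d_def]

lemmas parameters = type_parameters[OF two Da(1,2) g d_def table(7,8)]

lemma dim_UNIV: "dim (UNIV :: 'a set) = (if n = 0 then 2 else 3)"
  using dim_eigenbasis[OF Da n v table(6)] v0 by simp

lemma distinct_axes: "a \<noteq> b" "a \<odot> b \<noteq> 0"
proof -
  show "a \<noteq> b"
  proof
    assume "a = b"
    then have "comb3 a n v 1 0 0 = comb3 a n v al 1 1" using b_comb3 by (simp add: comb3_basis)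
    then show False unfolding eq_iff using v0 by simp
  qed
  show "a \<odot> b \<noteq> 0"
  proof
    assume "a \<odot> b = 0"
    then have "comb3 a n v al 0 lam = comb3 a n v 0 0 0" using a_mult_b by (simp add: comb3_def)
    then show False unfolding eq_iff using v0 Da by simp
  qed
qed

lemma identity_eq:
  assumes "g \<noteq> 0"
  shows "(1 / g) *s s = a + (1 / d) *s n"
  using assms Da unfolding s_eq d_def by (simp add: scale_right_diff_distrib)

lemma tau_b: "tau lam a b = comb3 a n v al 1 (- 1)"
  using tau_decomposed[OF Da(1,2,4) n v, of al] unfolding b by (simp add: comb3_def)

section \<open>The three kinds of algebra with nonzero odd component\<close>

lemma matsuo_case:
  assumes half: "lam \<noteq> 1 / 2"
  defines "i \<equiv> a + (1 / d) *s n"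
  shows "g = 0 \<Longrightarrow> lam = - 1 \<and> Idem = {a, b, - a - b + 2 *s s}"
    "g \<noteq> 0 \<Longrightarrow> Idem = {a, i - a, b, i - b, tau lam a b, i - tau lam a b}"
    "g \<noteq> 0 \<Longrightarrow> is_identity i"
    "g \<noteq> 0 \<Longrightarrow> card Idem = 6"
    "nontrivial_idempotent e \<Longrightarrow> primitive_axis e"
    "primitive_axis_of_type mu c \<Longrightarrow> primitive_axis_of_type mu c' \<Longrightarrow> conjugate c c'"
proof -
  have dbl: "A = B" if "2 * A = 2 * B" for A B :: 'f using that two by simp
  have lam1: "1 - lam \<noteq> 0" using Da by simp
  have dg: "d = 0 \<longleftrightarrow> g = 0" using Da by (simp add: d_def)
  \<comment> \<open>If \<open>lam' = 1 - lam\<close>, the axis of type \<open>lam\<close> is not \<open>b\<close> but \<open>i - tau lam a b\<close>, and \<open>y\<close> is its \<open>n\<close>-coordinate.\<close>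
  obtain y where alt: "(lam' = lam \<and> y = 1 \<and> 2 * al = lam \<and> 2 * d = 1 + lam) \<or>
       (y * (1 - lam) = 1 + lam \<and> 2 * al = 2 - lam \<and> 2 * d = 1 - lam)"
    using parameters(2)[OF half] that[of 1] that[of "(1 + lam) / (1 - lam)"] lam1 by auto
  have y1: "2 * y * d = 1 + lam" using alt by auto algebra
  have y2: "1 - d = y - y * y * d"
    using alt
  proof
    assume "y * (1 - lam) = 1 + lam \<and> 2 * al = 2 - lam \<and> 2 * d = 1 - lam"
    then have A: "y * (1 - lam) = 1 + lam" "2 * d = 1 - lam" by auto
    have "(1 - lam) * (2 * (1 - d)) = (1 - lam) * (2 * (y - y * y * d))" using A by algebra
    then have "2 * (1 - d) = 2 * (y - y * y * d)" using mult_left_cancel[OF lam1] by blast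
    then show ?thesis by (rule dbl)
  qed auto
  define l where "l = lam / 2"
  have l: "lam = 2 * l" "lam / 2 = l" using two by (simp_all add: l_def)
  have "al = l \<or> al = 1 - l" 
  proof -
    have "2 * al = 2 * l \<or> 2 * al = 2 * (1 - l)" using alt l(1) by (auto simp: right_diff_distrib)
    then show ?thesis using dbl by blast
  qed
  \<comment> \<open>The product \<open>al * (1 - al)\<close> is unchanged under
    \<open>al \<mapsto> 1 - al\<close>, so both branches have the multiplication table of
    \<open>matsuo_frame\<close>.\<close>
  then have k: "al - al * al = lam / 2 - lam / 2 * (lam / 2)"
  proof
    assume al: "al = l" show ?thesis unfolding al l(2) ..
  next
    assume al: "al = 1 - l" show ?thesis unfolding al l(2) by (simp add: algebra_simps)
  qed
  have n0: "n = 0 \<longrightarrow> d = 0" using table(5) dg by blast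
  note M = matsuo_axes[OF two half Da n v v0 table(1,2) table(3)[unfolded k] y1 y2 n0 table(6), folded i_def]
  show "is_identity i" if "g \<noteq> 0" using M(3) that dg by blast
  show "card Idem = 6" if "g \<noteq> 0" using M(4) that dg by blast
  show "nontrivial_idempotent e \<Longrightarrow> primitive_axis e" by (rule M(5))
  show "primitive_axis_of_type mu c \<Longrightarrow> primitive_axis_of_type mu c' \<Longrightarrow> conjugate c c'" by (rule M(6))
  define p where "p = comb3 a n v (lam / 2) y 1"
  define q where "q = comb3 a n v (lam / 2) y (- 1)"
  have pq: "(p = b \<and> q = tau lam a b) \<or> (d \<noteq> 0 \<and> i - q = b \<and> i - p = tau lam a b)"
    using alt
  proof
    assume "lam' = lam \<and> y = 1 \<and> 2 * al = lam \<and> 2 * d = 1 + lam"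
    then have y: "y = 1" and al: "lam / 2 = al" using two by auto
    show ?thesis unfolding p_def q_def tau_b y al by (simp add: b_comb3[symmetric])
  next
    assume "y * (1 - lam) = 1 + lam \<and> 2 * al = 2 - lam \<and> 2 * d = 1 - lam"
    then have A: "y * (1 - lam) = 1 + lam" "2 * al = 2 - lam" "2 * d = 1 - lam" by auto
    have d0: "d \<noteq> 0" using A(3) lam1 by auto
    have al: "1 - l = al" using A(2) l(1) by - (rule dbl, simp add: algebra_simps)
    \<comment> \<open>This makes the \<open>n\<close>-coordinate \<open>1 / d - y\<close> of
      \<open>i - q\<close> equal to 1, as \<open>b\<close> requires.\<close>
    have "2 * d * (1 + y) = 2 * 1" using A by algebra
    then have "d * (1 + y) = 1" by - (rule dbl, simp add: mult.assoc)
    then have y: "1 / d - y = 1" using d0 by (simp add: field_simps)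
    have i: "i = comb3 a n v 1 (1 / d) 0" by (simp add: i_def comb3_def)
    have "i - q = comb3 a n v al 1 1" "i - p = comb3 a n v al 1 (- 1)"
      unfolding i p_def q_def l(2) comb3_diff al y by simp_all
    then show ?thesis unfolding tau_b using b_comb3 d0 by simp
  qed
  show "Idem = {a, i - a, b, i - b, tau lam a b, i - tau lam a b}" if "g \<noteq> 0"
  proof -
    have N: "Idem = {a, i - a, p, i - p, q, i - q}" using M(2) that dg unfolding p_def q_def by blast
    have ii: "x = i - z" if "i - x = z" for x z using that by (simp add: algebra_simps)
    from pq show ?thesis
    proof
      assume "p = b \<and> q = tau lam a b" then show ?thesis using N by simp
    next
      assume "d \<noteq> 0 \<and> i - q = b \<and> i - p = tau lam a b"
      then have e: "i - q = b" "i - p = tau lam a b" by auto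
      then have "q = i - b" "p = i - tau lam a b" by (auto intro: ii)
      note e this
      then show ?thesis using N by auto
    qed
  qed
  show "lam = - 1 \<and> Idem = {a, b, - a - b + 2 *s s}" if g0: "g = 0"
  proof -
    have P: "lam = - 1" "2 * al = - 1" "d = 0" using parameters(3)[OF half g0] by auto
    have pb: "p = b" "q = tau lam a b" using pq P(3) by auto
    have N: "Idem = {a, b, tau lam a b}" using M(1)[OF P(3)] pb unfolding p_def q_def by simp
    \<comment> \<open>With \<open>g = 0\<close> and \<open>lam = - 1\<close> one has
      \<open>s = n\<close>, so \<open>- a - b + 2 *s s\<close> already agrees with the reflected
      \<open>b\<close> in the coordinates of \<open>n\<close> and \<open>v\<close>; this settles the
      coordinate of \<open>a\<close>.\<close>
    have "- 1 - al = al" using P(2) by - (rule dbl, simp add: algebra_simps)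
    moreover have "- a - b + 2 *s s = comb3 a n v (- 1 - al) 1 (- 1)"
      unfolding s_eq g0 P(1) b
      by (simp add: comb3_def scale_left_diff_distrib scale_two algebra_simps)
    ultimately have "- a - b + 2 *s s = tau lam a b" unfolding tau_b by simp
    then show ?thesis using N P(1) by simp
  qed
qed

lemma parabola_case:
  assumes half: "lam = 1 / 2" and g0: "g = 0"
  shows "al = 1" "Idem = {x *s a + (1 - x) *s b + (2 * x * (1 - x)) *s s | x. True}"
    "nontrivial_idempotent e \<Longrightarrow> primitive_axis e" "conjugate b a"
proof -
  have P: "al = 1" "d = 0" using parameters(1)[OF half] g0 by auto
  show "al = 1" by (rule P)
  have v': "a \<odot> v = (1 / 2) *s v" using v half by simp
  have tab: "n \<odot> n = 0" "n \<odot> v = 0" "v \<odot> v = n" using table(1-3) P by simp_all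
  note Q = parabola_axis[OF two Da(3,4) n v' v0 tab table(6)]
  \<comment> \<open>Here \<open>a\<close> and \<open>b\<close> are the points of the parabola with
    parameters 0 and 1, and \<open>s = - n / 2\<close> supplies the quadratic correction;
    \<open>x\<close> corresponds to the parameter \<open>1 - x\<close>.\<close>
  have eq: "x *s a + (1 - x) *s b + (2 * x * (1 - x)) *s s = comb3 a n v 1 ((1 - x)\<^sup>2) (1 - x)" for x
  proof -
    have "comb3 a n v 1 0 0 = a" by (simp add: comb3_basis)
    have sn: "s = comb3 a n v 0 (- (1 / 2)) 0" unfolding s_eq g0 half by (simp add: comb3_def)
    have "x *s comb3 a n v 1 0 0 + (1 - x) *s comb3 a n v al 1 1 + (2 * x * (1 - x)) *s comb3 a n v 0 (- (1 / 2)) 0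
       = comb3 a n v 1 ((1 - x)\<^sup>2) (1 - x)"
      unfolding comb3_linear P(1) using two by (intro comb3_cong) (simp_all add: power2_eq_square algebra_simps)
    then show ?thesis using sn b_comb3 by (simp add: comb3_basis)
  qed
  show "Idem = {x *s a + (1 - x) *s b + (2 * x * (1 - x)) *s s | x. True}"
    unfolding Q(3) eq by (metis (no_types, opaque_lifting) diff_diff_eq2 add_diff_cancel_left')
  show "primitive_axis e" if e: "nontrivial_idempotent e"
  proof -
    obtain r where "e = comb3 a n v 1 (r\<^sup>2) r" using e Q(3) by blast
    then show ?thesis unfolding primitive_axis_def using Q(1) by blast
  qed
  \<comment> \<open>Reflection at the midpoint 1/2 of the parameters of \<open>b\<close> and
    \<open>a\<close>.\<close>
  have "tau (1 / 2) (comb3 a n v 1 ((1 / 2)\<^sup>2) (1 / 2)) (comb3 a n v 1 (1\<^sup>2) 1) = comb3 a n v 1 ((2 * (1 / 2) - 1)\<^sup>2) (2 * (1 / 2) - 1)"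
    by (rule Q(2))
  then have "tau (1 / 2) (comb3 a n v 1 ((1 / 2)\<^sup>2) (1 / 2)) b = a"
    using two b_comb3 P by (simp add: comb3_basis)
  then show "conjugate b a" by (rule conjugateI[OF Q(1)])
qed

lemma spin_case:
  assumes half: "lam = 1 / 2" and g0: "g \<noteq> 0"
  defines "i \<equiv> a + (1 / d) *s n"
  shows "is_identity i"
    "Idem = {x *s a + (1 - x) *s (i - a) + z *s v | x z. z\<^sup>2 * al * (1 - al) = x * (1 - x)}"
    "nontrivial_idempotent e \<Longrightarrow> primitive_axis e"
    "al \<noteq> 0 \<Longrightarrow> conjugate b a \<longleftrightarrow> (\<exists>r. r\<^sup>2 = al)"
    "al = 0 \<Longrightarrow> c \<in> {a, i - a} \<Longrightarrow> {c + r *s v | r. True} =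
       {tau mu e (c + t *s v) | e mu. primitive_axis_of_type mu e}"
proof -
  define f where "f = (1 / d) *s n"
  have d: "d = 1 - al" "d \<noteq> 0" using parameters(1)[OF half] g0 Da by (auto simp: d_def)
  have nf: "n = d *s f" using d by (simp add: f_def)
  have n0: "n \<noteq> 0" using table(5) g0 by blast
  then have f0: "f \<noteq> 0" using d by (simp add: f_def)
  have v': "a \<odot> v = (1 / 2) *s v" using v half by simp
  have af: "a \<odot> f = 0" using n by (simp add: f_def mult_linear)
  have ff: "f \<odot> f = f" using table(1) d by (simp add: f_def mult_linear)
  have fv: "f \<odot> v = (1 / 2) *s v" 
  proof -
    have "f \<odot> v = (1 - lam) *s v" using table(2) d(2) by (simp add: f_def mult_linear)
    also have "1 - lam = 1 / 2" unfolding half using two by (simp add: field_simps)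
    finally show ?thesis .
  qed
  \<comment> \<open>In the basis \<open>a\<close>, \<open>f\<close>, \<open>v\<close> the axis
    \<open>b\<close> has coordinates \<open>al\<close>, \<open>1 - al\<close>, 1, so this is the
    value of \<open>k\<close> for which \<open>b\<close> satisfies the norm equation of
    \<open>spin_axis\<close>.\<close>
  define k where "k = al * (1 - al)"
  have vv: "v \<odot> v = k *s a + k *s f"
    unfolding table(3) unfolding nf d(1) k_def by (simp add: algebra_simps)
  have span: "\<exists>x y z. u = comb3 a f v x y z" for u
  proof -
    obtain x y z where "u = comb3 a n v x y z" using table(6) by blast
    then have "u = comb3 a f v x (y * d) z" unfolding nf by (simp add: comb3_def)
    then show ?thesis by blast
  qed
  note S = spin_axis[OF two Da(3,4) af f0 v' v0 ff fv vv span]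
  have i: "i = a + f" by (simp add: i_def f_def)
  show "is_identity i" unfolding i by (rule S(4))
  have kk: "z\<^sup>2 * al * (1 - al) = z\<^sup>2 * k" for z by (simp add: k_def)
  show "Idem = {x *s a + (1 - x) *s (i - a) + z *s v | x z. z\<^sup>2 * al * (1 - al) = x * (1 - x)}"
    unfolding S(3) kk i by (simp add: comb3_def)
  show "primitive_axis e" if e: "nontrivial_idempotent e"
  proof -
    obtain x z where "e = comb3 a f v x (1 - x) z" "z\<^sup>2 * k = x * (1 - x)" using e S(3) by blast
    then show ?thesis unfolding primitive_axis_def using S(1) by blast
  qed
  have bf: "b = comb3 a f v al (1 - al) 1" using b_comb3 unfolding nf d(1) by (simp add: comb3_def)
  note eq = comb3_eq_iff[OF Da af v]
  show "conjugate b a \<longleftrightarrow> (\<exists>r. r\<^sup>2 = al)" if al0: "al \<noteq> 0"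
  proof
    assume "conjugate b a"
    then obtain e mu where e: "primitive_axis_of_type mu e" "tau mu e b = a" unfolding conjugate_iff by blast
    obtain x z where xz: "mu = 1 / 2" "e = comb3 a f v x (1 - x) z" "z\<^sup>2 * k = x * (1 - x)" using S(5)[OF e(1)] by blast
    \<comment> \<open>\<open>W\<close> is the inner product of the norm 1 vectors of
      \<open>b\<close> and \<open>e\<close>, and \<open>p\<close> below is that of \<open>a\<close>
      and \<open>e\<close>. A reflection in \<open>e\<close> taking \<open>b\<close> to
      \<open>a\<close> makes them equal, and \<open>W * p = al\<close> then exhibits
      \<open>p\<close> as a square root.\<close>
    define W where "W = (al - (1 - al)) * (2 * x - 1) + 4 * k * 1 * z"
    have "comb3 a f v (1 - al + W * (2 * x - 1)) (al - W * (2 * x - 1)) (2 * W * z - 1) = comb3 a f v 1 0 0"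
      using S(2)[OF xz(3) W_def] e(2) xz(1,2) unfolding bf comb3_basis by simp
    then have E: "W * (2 * x - 1) = al" "2 * W * z = 1"
      unfolding eq using v0 by (auto simp: algebra_simps)
    define p where "p = 2 * x - 1"
    have pp: "p * p + 4 * k * z * z = 1" using xz(3) unfolding p_def by algebra
    have "W * (p * p + 4 * k * z * z) = (W * p) * p + 2 * k * z * (2 * W * z)" by (simp add: algebra_simps)
    then have W: "W = al * p + 2 * k * z" unfolding pp E(2) unfolding p_def E(1) by simp
    have "(al - 1) * p + 2 * k * z = 0" using W W_def unfolding p_def[symmetric] by algebra
    then have "d * (p - al * (2 * z)) = 0" unfolding k_def d(1) by algebra
    then have p: "p = al * (2 * z)" using d(2) by simp
    have "W = p" using W p unfolding k_def by algebra
    then have "p\<^sup>2 = al" using E(1) unfolding p_def[symmetric] by (simp add: power2_eq_square)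
    then show "\<exists>r. r\<^sup>2 = al" by blast
  next
    assume "\<exists>r. r\<^sup>2 = al"
    then obtain r where r: "r\<^sup>2 = al" by blast
    then have r0: "r \<noteq> 0" using al0 by auto
    \<comment> \<open>The mirror is the normalised sum of the norm 1 vectors of \<open>a\<close> and
      \<open>b\<close>. That sum has norm \<open>4 * al\<close>, which is the square of
      \<open>2 * r\<close>.\<close>
    define x where "x = (r + 1) / 2"
    define z where "z = 1 / (2 * r)"
    have "2 * x = r + 1" unfolding x_def using two by simp
    then have X: "2 * x - 1 = r" by simp
    have Z: "2 * z * r = 1" using two r0 by (simp add: z_def)
    have dbl: "A = B" if "2 * (2 * A) = 2 * (2 * B)" for A B :: 'f
      using that mult_left_cancel[OF two] by blast
    have xz: "z\<^sup>2 * k = x * (1 - x)"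
    proof (rule dbl)
      have "(2 * z)\<^sup>2 * k = 1 - r\<^sup>2" using Z r unfolding k_def by algebra
      then show "2 * (2 * (z\<^sup>2 * k)) = 2 * (2 * (x * (1 - x)))" using X by algebra
    qed
    have W: "r = (al - (1 - al)) * (2 * x - 1) + 4 * k * 1 * z"
    proof -
      have "4 * k * 1 * z = 2 * r * (1 - r\<^sup>2) * (2 * z * r)"
        unfolding k_def r[symmetric] by (simp add: power2_eq_square algebra_simps)
      then show ?thesis unfolding Z X unfolding r[symmetric] by (simp add: power2_eq_square algebra_simps)
    qed
    have "tau (1 / 2) (comb3 a f v x (1 - x) z) b = comb3 a f v (1 - al + r * r) (al - r * r) (2 * r * z - 1)"
      using S(2)[OF xz W] unfolding X bf .
    also have "\<dots> = comb3 a f v 1 0 0" using r Z by (intro comb3_cong) (auto simp: power2_eq_square algebra_simps)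
    finally show "conjugate b a" using conjugateI[OF S(1)[OF xz]] unfolding comb3_basis by blast
  qed
  show "{c + r *s v | r. True} = {tau mu e (c + t *s v) | e mu. primitive_axis_of_type mu e}"
    if al0: "al = 0" and c: "c \<in> {a, i - a}"
  proof -
    \<comment> \<open>The form is now degenerate with \<open>v\<close> in its radical, so axes have
      \<open>x\<close> in {0, 1} and arbitrary \<open>z\<close>. The axis with \<open>x = 1\<close>
      sends the parameter \<open>t\<close> to \<open>2 * z - t\<close> on the line of
      \<open>a\<close> and to \<open>- 2 * z - t\<close> on that of \<open>f\<close>, so every
      target is reached.\<close>
    have k0: "k = 0" by (simp add: k_def al0)
    have ca: "c = a \<or> c = f" using c i by auto
    have ax1: "primitive_axis_of_type (1 / 2) (comb3 a f v 1 (1 - 1) z)" for z by (rule S(1)) (simp add: k0)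
    have ta: "tau (1 / 2) (comb3 a f v x (1 - x) z) (comb3 a f v 1 0 t) = comb3 a f v 1 0 (2 * (2 * x - 1) * z - t)"
      and tf: "tau (1 / 2) (comb3 a f v x (1 - x) z) (comb3 a f v 0 1 t) = comb3 a f v 0 1 (- 2 * (2 * x - 1) * z - t)"
      if x: "x * (1 - x) = 0" for x z
    proof -
      have xz: "z\<^sup>2 * k = x * (1 - x)" using x k0 by simp
      have x: "x = 0 \<or> x = 1" using x by auto
      show "tau (1 / 2) (comb3 a f v x (1 - x) z) (comb3 a f v 1 0 t) = comb3 a f v 1 0 (2 * (2 * x - 1) * z - t)"
        unfolding S(2)[OF xz refl] using x k0 by (intro comb3_cong) (auto simp: algebra_simps)
      show "tau (1 / 2) (comb3 a f v x (1 - x) z) (comb3 a f v 0 1 t) = comb3 a f v 0 1 (- 2 * (2 * x - 1) * z - t)"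
        unfolding S(2)[OF xz refl] using x k0 by (intro comb3_cong) (auto simp: algebra_simps)
    qed
    have ac: "a + r *s v = comb3 a f v 1 0 r" "f + r *s v = comb3 a f v 0 1 r" for r by (simp_all add: comb3_def)
    show ?thesis
    proof (intro equalityI subsetI)
      fix u assume "u \<in> {c + r *s v | r. True}"
      then obtain r where u: "u = c + r *s v" by blast
      define z where "z = (if c = a then (r + t) / 2 else - ((r + t) / 2))"
      have half_sum: "2 * ((r + t) / 2) = r + t" using two by simp
      have "tau (1 / 2) (comb3 a f v 1 (1 - 1) z) (c + t *s v) = u"
        using ca
      proof
        assume c: "c = a"
        then have "2 * (2 * 1 - 1) * z - t = r" using half_sum by (simp add: z_def del: times_divide_eq_right)
        then show ?thesis unfolding u c ac using ta[of 1 z] by simp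
      next
        assume c: "c = f"
        have "f \<noteq> a" using af ff Da by auto
        then have "- 2 * (2 * 1 - 1) * z - t = r" using half_sum c by (simp add: z_def del: times_divide_eq_right)
        then show ?thesis unfolding u c ac using tf[of 1 z] by simp
      qed
      then show "u \<in> {tau mu e (c + t *s v) | e mu. primitive_axis_of_type mu e}" using ax1 by blast
    next
      fix u assume "u \<in> {tau mu e (c + t *s v) | e mu. primitive_axis_of_type mu e}"
      then obtain e mu where e: "primitive_axis_of_type mu e" "u = tau mu e (c + t *s v)" by blast
      obtain x z where xz: "mu = 1 / 2" "e = comb3 a f v x (1 - x) z" "z\<^sup>2 * k = x * (1 - x)" using S(5)[OF e(1)] by blast
      have x: "x * (1 - x) = 0" using xz(3) k0 by simp
      from ca show "u \<in> {c + r *s v | r. True}"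
        using ta[OF x] tf[OF x] unfolding e(2) xz(1,2) ac by (elim disjE) (auto simp: ac)
    qed
  qed
qed

end
end

text \<open>The conditions on single claims exclude degenerate algebras: distinct orthogonal axes
  are fixed by every involution, and with nonzero odd component, type other than one half and
  \<open>\<gamma> = 0\<close> there are three idempotents instead of six.\<close>

theorem theoremH:
  fixes scale :: "'f::field \<Rightarrow> 'a::ab_group_add \<Rightarrow> 'a" (infixr "*s" 75)
    and mult :: "'a \<Rightarrow> 'a \<Rightarrow> 'a" (infixl "\<odot>" 70)
    and lam lam' \<alpha>\<^sub>b \<gamma> :: 'f
    and a b b\<^sub>0 b\<^sub>l \<sigma> :: 'a
  assumes char: "(2::'f) \<noteq> 0"
    and alg: "comm_algebra scale mult"
    and gen: "comm_algebra.generated_subalgebra scale mult {a, b} = UNIV"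
    and axis_a: "comm_algebra.primitive_axis_of_type scale mult lam a"
    and axis_b: "comm_algebra.primitive_axis_of_type scale mult lam' b"
    and b: "b = \<alpha>\<^sub>b *s a + b\<^sub>0 + b\<^sub>l"
    and b\<^sub>0: "b\<^sub>0 \<in> comm_algebra.eigenspace scale mult 0 a"
    and b\<^sub>l: "b\<^sub>l \<in> comm_algebra.eigenspace scale mult lam a"
    and \<sigma>: "\<sigma> = a \<odot> b - lam' *s a - lam *s b"
    and \<gamma>: "\<gamma> = \<alpha>\<^sub>b * (1 - lam) - lam'"
  shows
    "let N = {e. comm_algebra.nontrivial_idempotent mult e};
         n = vector_space.dim scale (UNIV :: 'a set)
     in
     (\<forall>e\<in>N. comm_algebra.primitive_axis scale mult e) \<and>

     (a \<noteq> b \<longrightarrow> n = 2 \<or> n = 3) \<and>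
     (a \<odot> b \<noteq> 0 \<and> n = 2 \<longrightarrow>
        (if lam = 1 / 2
         then N = {\<mu> *s a + (1 - \<mu>) *s b | \<mu>. True}
         else lam = - 1 \<and> N = {a, b, - a - b})) \<and>
     (n = 3 \<and> \<gamma> = 0 \<longrightarrow>
        (if lam = 1 / 2
         then N = {\<mu> *s a + (1 - \<mu>) *s b + (2 * \<mu> * (1 - \<mu>)) *s \<sigma> | \<mu>. True}
         else lam = - 1 \<and> N = {a, b, - a - b + 2 *s \<sigma>})) \<and>
     (n = 3 \<and> \<gamma> \<noteq> 0 \<longrightarrow>
        (let one = (1 / \<gamma>) *s \<sigma>; b' = comm_algebra.miyamoto scale mult lam a b in
         comm_algebra.is_identity mult one \<and>
         (if lam = 1 / 2
          then N = {\<alpha> *s a + (1 - \<alpha>) *s (one - a) + \<rho> *s b\<^sub>l | \<alpha> \<rho>.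
                      \<rho>\<^sup>2 * \<alpha>\<^sub>b * (1 - \<alpha>\<^sub>b) = \<alpha> * (1 - \<alpha>)}
          else N = {a, one - a, b, one - b, b', one - b'}))) \<and>

     (lam \<noteq> 1 / 2 \<longrightarrow>
        (n = 3 \<and> \<gamma> \<noteq> 0 \<longrightarrow> card N = 6) \<and>
        (a \<odot> b \<noteq> 0 \<longrightarrow>
           (\<forall>c d \<mu>. comm_algebra.primitive_axis_of_type scale mult \<mu> c \<and>
                    comm_algebra.primitive_axis_of_type scale mult \<mu> d \<longrightarrow>
                    comm_algebra.conjugate scale mult c d))) \<and>

     (lam = 1 / 2 \<longrightarrow>
        (\<alpha>\<^sub>b \<noteq> 0 \<longrightarrow>
           (comm_algebra.conjugate scale mult b a \<longleftrightarrow> (\<exists>r. r\<^sup>2 = \<alpha>\<^sub>b))) \<and>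
        (\<alpha>\<^sub>b = 0 \<longrightarrow>
           (\<exists>one. comm_algebra.is_identity mult one \<and>
              (\<forall>d \<in> {a, one - a}.
                 let E = {d + \<rho> *s b\<^sub>l | \<rho>. True} in
                 \<forall>e\<^sub>1\<in>E. E = {comm_algebra.miyamoto scale mult \<mu> e e\<^sub>1 | e \<mu>.
                                comm_algebra.primitive_axis_of_type scale mult \<mu> e}))))"
proof -
  interpret axis_pair scale mult lam lam' \<alpha>\<^sub>b \<gamma> a b b\<^sub>0 b\<^sub>l \<sigma>
  proof -
    interpret comm_algebra scale mult by (rule alg)
    show "axis_pair scale mult lam lam' \<alpha>\<^sub>b \<gamma> a b b\<^sub>0 b\<^sub>l \<sigma>"
      using char gen axis_a axis_b b b\<^sub>0 b\<^sub>l \<sigma> \<gamma> by unfold_locales (simp_all add: eigenspace_def)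
  qed
  let ?n = "dim (UNIV :: 'a set)"
  have mi: "miyamoto lam a b = tau lam a b" by (simp add: miyamoto_eq_tau[OF axis_a])
  have mis: "{miyamoto mu e x | e mu. primitive_axis_of_type mu e} = {tau mu e x | e mu. primitive_axis_of_type mu e}" for x
    using miyamoto_eq_tau by (metis (no_types, lifting))
  show ?thesis
  proof (cases "b\<^sub>l = 0")
    \<comment> \<open>Now \<open>a\<close> has no odd eigenvector, so \<open>lam\<close> is an
      arbitrary admissible scalar and \<open>\<gamma>\<close> depends on that choice. The claims are
      decided by the dimension, by \<open>a \<odot> b\<close> and by the coefficient of
      \<open>a\<close> in \<open>b\<close>.\<close>
    case True
    from zero_odd_part_cases[OF True] show ?thesis
    proof
      assume A: "a = b \<and> \<alpha>\<^sub>b = 1 \<and> b\<^sub>0 = 0"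
      then have eq: "a = b" and al: "\<alpha>\<^sub>b = 1" by auto
      note E = equal_axes[OF eq]
      have n: "?n = 1" by (rule E)
      have c: "conjugate c d" if "primitive_axis_of_type mu c" "primitive_axis_of_type mu d" for c d mu
        using E(3)[OF that(1)] E(3)[OF that(2)] E(4) by simp
      have cb: "conjugate b a" using E(4) eq by simp
      have r: "\<exists>r. r\<^sup>2 = \<alpha>\<^sub>b" using al by (intro exI[of _ 1]) simp
      have N: "\<forall>e\<in>Idem. primitive_axis e" using E(2) by blast
      show ?thesis
        unfolding Let_def
        by (intro conjI impI N; (use n eq al cb r c in \<open>simp; fail\<close>)?) (use n eq al cb r c in auto)
    next
      assume A: "a \<noteq> b \<and> a \<odot> b = 0 \<and> \<alpha>\<^sub>b = 0 \<and> b\<^sub>0 = b"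
      then have ne: "a \<noteq> b" and ab: "a \<odot> b = 0" and al: "\<alpha>\<^sub>b = 0" by auto
      note O = orthogonal_axes[OF ne ab]
      have n: "?n = 2" by (rule O)
      have N: "\<forall>e\<in>Idem. primitive_axis e"
        unfolding O(2) primitive_axis_def using axis_a axis_b by blast
      \<comment> \<open>Each set \<open>E\<close> is a single point, because the odd vector is zero,
        and each involution fixes it.\<close>
      have last: "\<exists>one. is_identity one \<and> (\<forall>d\<in>{a, one - a}. \<forall>e\<^sub>1\<in>{d + \<rho> *s b\<^sub>l | \<rho>. True}.
         {d + \<rho> *s b\<^sub>l | \<rho>. True} = {miyamoto mu e e\<^sub>1 | e mu. primitive_axis_of_type mu e})"
      proof (intro exI[of _ "a + b"] conjI ballI O(3))
        fix d e\<^sub>1 assume d: "d \<in> {a, a + b - a}" and e: "e\<^sub>1 \<in> {d + \<rho> *s b\<^sub>l | \<rho>. True}"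
        have d': "d \<in> {a, b}" using d by auto
        have e1: "e\<^sub>1 = d" using e True by auto
        have "{tau mu e d | e mu. primitive_axis_of_type mu e} = {d}"
        proof (intro equalityI subsetI)
          fix x assume "x \<in> {tau mu e d | e mu. primitive_axis_of_type mu e}"
          then show "x \<in> {d}" using O(4)[OF _ d'] by auto
        next
          fix x assume "x \<in> {d}"
          then have "x = tau lam a d" using O(4)[OF axis_a d'] by simp
          then show "x \<in> {tau mu e d | e mu. primitive_axis_of_type mu e}" using axis_a by blast
        qed
        then show "{d + \<rho> *s b\<^sub>l | \<rho>. True} = {miyamoto mu e e\<^sub>1 | e mu. primitive_axis_of_type mu e}"
          unfolding mis e1 True by simp
      qed
      show ?thesis
        unfolding Let_def
        by (intro conjI impI N last) (use n ne ab al in simp_all)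
    qed
  next
    case False
    note n = dim_UNIV[OF False] and ne = distinct_axes[OF False]
    have g3: "b\<^sub>0 = 0 \<Longrightarrow> \<gamma> = 0" by (rule table(5)[OF False])
    \<comment> \<open>In dimension 2 this makes \<open>\<sigma>\<close> vanish, so the description
      there is the one for \<open>\<gamma> = 0\<close> with the term in \<open>\<sigma>\<close>
      dropped.\<close>
    have s0: "b\<^sub>0 = 0 \<Longrightarrow> \<gamma> = 0 \<Longrightarrow> \<sigma> = 0" using s_eq by simp
    have n2: "b\<^sub>0 = 0" if "?n = 2" using n that by (auto split: if_splits)
    have n23: "a \<noteq> b \<longrightarrow> ?n = 2 \<or> ?n = 3" using n by simp
    show ?thesis
    proof (cases "lam = 1 / 2")
      case half: False
      note M = matsuo_case[OF False half]
      have N: "\<forall>e\<in>Idem. primitive_axis e" using M(5) by blast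
      have g2: "lam = - 1 \<and> Idem = {a, b, - a - b}" if "?n = 2"
        using M(1) s0 g3 n2[OF that] by simp
      have id: "is_identity ((1 / \<gamma>) *s \<sigma>)"
        and I: "Idem = {a, (1 / \<gamma>) *s \<sigma> - a, b, (1 / \<gamma>) *s \<sigma> - b, miyamoto lam a b, (1 / \<gamma>) *s \<sigma> - miyamoto lam a b}"
        if "\<gamma> \<noteq> 0"
        unfolding identity_eq[OF False that] mi using M(2,3)[OF that] by blast+
      show ?thesis
        unfolding Let_def if_not_P[OF half]
      proof (intro conjI impI N n23)
        show "lam = - 1" "Idem = {a, b, - a - b}" if "a \<odot> b \<noteq> 0 \<and> ?n = 2" using g2 that by blast+
        show "lam = - 1" "Idem = {a, b, - a - b + 2 *s \<sigma>}" if "?n = 3 \<and> \<gamma> = 0" using M(1) that by blast+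
        show "is_identity ((1 / \<gamma>) *s \<sigma>)"
          "Idem = {a, (1 / \<gamma>) *s \<sigma> - a, b, (1 / \<gamma>) *s \<sigma> - b, miyamoto lam a b, (1 / \<gamma>) *s \<sigma> - miyamoto lam a b}"
          if "?n = 3 \<and> \<gamma> \<noteq> 0" using id I that by blast+
        show "card Idem = 6" if "?n = 3 \<and> \<gamma> \<noteq> 0" using M(4) that by blast
        show "\<forall>c d \<mu>. primitive_axis_of_type \<mu> c \<and> primitive_axis_of_type \<mu> d \<longrightarrow> conjugate c d"
          using M(6) by blast
      qed (use half n23 in blast)+
    next
      case half: True
      show ?thesis
      proof (cases "\<gamma> = 0")
        case g0: True
        note M = parabola_case[OF False half g0]
        have N: "\<forall>e\<in>Idem. primitive_axis e" using M(3) by blast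
        have g2: "Idem = {\<mu> *s a + (1 - \<mu>) *s b | \<mu>. True}" if "?n = 2"
          unfolding M(2) s0[OF n2[OF that] g0] by simp
        have r: "\<exists>r. r\<^sup>2 = \<alpha>\<^sub>b" using M(1) by (intro exI[of _ 1]) simp
        show ?thesis
          unfolding Let_def if_P[OF half]
        proof (intro conjI impI N n23 M(2))
          show "Idem = {\<mu> *s a + (1 - \<mu>) *s b | \<mu>. True}" if "a \<odot> b \<noteq> 0 \<and> ?n = 2" using g2 that by blast
          show "conjugate b a \<longleftrightarrow> (\<exists>r. r\<^sup>2 = \<alpha>\<^sub>b)" using r M(4) by blast
        qed (use half g0 n23 M(1) in simp_all)
      next
        case g0: False
        note M = spin_case[OF False half g0, folded identity_eq[OF False g0]]
        have N: "\<forall>e\<in>Idem. primitive_axis e" using M(3) by blast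
        have n3: "?n \<noteq> 2" using n2 g3 g0 by blast
        have last: "\<exists>one. is_identity one \<and> (\<forall>d\<in>{a, one - a}. \<forall>e\<^sub>1\<in>{d + \<rho> *s b\<^sub>l | \<rho>. True}.
           {d + \<rho> *s b\<^sub>l | \<rho>. True} = {miyamoto mu e e\<^sub>1 | e mu. primitive_axis_of_type mu e})" if "\<alpha>\<^sub>b = 0"
        proof (intro exI[of _ "(1 / \<gamma>) *s \<sigma>"] conjI ballI M(1))
          fix d e\<^sub>1 assume d: "d \<in> {a, (1 / \<gamma>) *s \<sigma> - a}" and e: "e\<^sub>1 \<in> {d + \<rho> *s b\<^sub>l | \<rho>. True}"
          obtain t where e1: "e\<^sub>1 = d + t *s b\<^sub>l" using e by blast
          show "{d + \<rho> *s b\<^sub>l | \<rho>. True} = {miyamoto mu e e\<^sub>1 | e mu. primitive_axis_of_type mu e}"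
            unfolding mis e1 by (rule M(5)[OF that d])
        qed
        show ?thesis
          unfolding Let_def if_P[OF half]
          by (intro conjI impI N n23 last M(1,2,4)) (use n3 g0 n23 half in simp_all)
      qed
    qed
  qed
qed
end
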